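(* Let $0<p<1/2$ and let $m=(m_0,m_1,\dots)$ be a bounded generating sequence. There is a constant $c_p<\infty$ (depending only on $p$ and $m$) such that for every martingale $f\in H_p(G_m)$, $$\Big\|\sup_{n\in\mathbb{N}_+}\frac{|\sigma_n f|}{(n+1)^{1/p-2}}\Big\|_{L_p(G_m)}\le c_p\,\|f\|_{H_p(G_m)}.$$ That is, the maximal operator $\widetilde{\sigma}_p^{*}f:=\sup_{n}|\sigma_n f|/(n+1)^{1/p-2}$ is bounded from $H_p(G_m)$ to $L_p(G_m)$.
   Context: Let $m=(m_0,m_1,\dots)$ be a sequence of integers $m_k\ge 2$ with $\sup_k m_k<\infty$ (bounded Vilenkin group). $Z_{m_k}=\{0,1,\dots,m_k-1\}$ is the additive group of integers mod $m_k$, and $G_m=\prod_k Z_{m_k}$ is the complete direct product, with elements $x=(x_0,x_1,\dots)$, $x_k\in Z_{m_k}$, product topology, and Haar measure $\mu$ = product of the uniform measures $\mu_k(\{j\})=1/m_k$, so $\mu(G_m)=1$. Set $M_0=1$, $M_{k+1}=m_kM_k$; every $n\in\mathbb{N}$ is uniquely $n=\sum_j n_jM_j$ with $n_j\in Z_{m_j}$. For $n\ge1$, $I_n(x)=\{y\in G_m: y_j=x_j,\ j<n\}$, $I_0(x)=G_m$, $I_n:=I_n(0)$. The generalized Rademacher functions are $r_k(x)=\exp(2\pi i x_k/m_k)$ and the Vilenkin system is $\psi_n=\prod_k r_k^{n_k}$. $\digamma_n$ is the $\sigma$-algebra generated by the intervals $I_n(x)$, $x\in G_m$. A martingale $f=(f^{(n)})$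 is with respect to $(\digamma_n)$; its maximal function is $f^*=\sup_n|f^{(n)}|$, and for $0<p<\infty$, $H_p(G_m)$ is the space of martingales with $\|f\|_{H_p}:=\|f^*\|_{L_p}<\infty$, where $\|g\|_{L_p}=(\int_{G_m}|g|^pd\mu)^{1/p}$. Fourier coefficients of a martingale are $\widehat f(i)=\lim_{k\to\infty}\int_{G_m}f^{(k)}\overline{\psi_i}\,d\mu$; partial sums $S_nf=\sum_{k=0}^{n-1}\widehat f(k)\psi_k$ ($S_0f=0$), Fejér means $\sigma_nf=\frac1n\sum_{k=0}^{n-1}S_kf$ ($n\ge1$). *)

theory Defs
  imports "HOL-Probability.Probability"
begin

text \<open>Bounded Vilenkin group G_m: elements are sequences x :: nat => nat with x k < m k.
  Haar measure: product of the uniform (normalized counting) measures on Z_{m_k}.\<close>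

definition vilenkin_measure :: "(nat \<Rightarrow> nat) \<Rightarrow> (nat \<Rightarrow> nat) measure" where
  "vilenkin_measure m = (\<Pi>\<^sub>M k\<in>UNIV. uniform_count_measure {..<m k})"

definition bounded_gen_seq :: "(nat \<Rightarrow> nat) \<Rightarrow> bool" where
  "bounded_gen_seq m \<longleftrightarrow> (\<forall>k. 2 \<le> m k) \<and> (\<exists>B. \<forall>k. m k \<le> B)"

definition Mprod :: "(nat \<Rightarrow> nat) \<Rightarrow> nat \<Rightarrow> nat" where
  "Mprod m k = (\<Prod>j<k. m j)"

definition digit :: "(nat \<Rightarrow> nat) \<Rightarrow> nat \<Rightarrow> nat \<Rightarrow> nat" where
  "digit m n k = (n div Mprod m k) mod m k"

definition rademacher :: "(nat \<Rightarrow> nat) \<Rightarrow> nat \<Rightarrow> (nat \<Rightarrow> nat) \<Rightarrow> complex" where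
  "rademacher m k x = cis (2 * pi * real (x k) / real (m k))"

text \<open>Vilenkin function psi_n = prod_k r_k^{n_k}; digits n_k vanish for k >= n since M_k >= 2^k > k.\<close>
definition vilenkin :: "(nat \<Rightarrow> nat) \<Rightarrow> nat \<Rightarrow> (nat \<Rightarrow> nat) \<Rightarrow> complex" where
  "vilenkin m n x = (\<Prod>k<n. rademacher m k x ^ digit m n k)"

text \<open>A martingale with respect to the filtration (F_n), F_n generated by the intervals I_n(x):
  f^(n) is F_n-measurable (depends only on x_0..x_{n-1}) and E(f^(n+1) | F_n) = f^(n)
  (conditional expectation on the atoms I_n(x) is the average over the coordinate x_n).\<close>
definition vmartingale :: "(nat \<Rightarrow> nat) \<Rightarrow> (nat \<Rightarrow> (nat \<Rightarrow> nat) \<Rightarrow> complex) \<Rightarrow> bool" where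
  "vmartingale m f \<longleftrightarrow>
     (\<forall>n x y. x \<in> space (vilenkin_measure m) \<longrightarrow> y \<in> space (vilenkin_measure m) \<longrightarrow>
         (\<forall>j<n. x j = y j) \<longrightarrow> f n x = f n y) \<and>
     (\<forall>n x. x \<in> space (vilenkin_measure m) \<longrightarrow>
         f n x = (\<Sum>j<m n. f (Suc n) (x(n := j))) / of_nat (m n))"

definition fourier_coeff :: "(nat \<Rightarrow> nat) \<Rightarrow> (nat \<Rightarrow> (nat \<Rightarrow> nat) \<Rightarrow> complex) \<Rightarrow> nat \<Rightarrow> complex" where
  "fourier_coeff m f i =
     lim (\<lambda>k. integral\<^sup>L (vilenkin_measure m) (\<lambda>x. f k x * cnj (vilenkin m i x)))"

definition partial_sum :: "(nat \<Rightarrow> nat) \<Rightarrow> (nat \<Rightarrow> (nat \<Rightarrow> nat) \<Rightarrow> complex) \<Rightarrow> nat \<Rightarrow> (nat \<Rightarrow> nat) \<Rightarrow> complex" where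
  "partial_sum m f n x = (\<Sum>k<n. fourier_coeff m f k * vilenkin m k x)"

definition fejer_mean :: "(nat \<Rightarrow> nat) \<Rightarrow> (nat \<Rightarrow> (nat \<Rightarrow> nat) \<Rightarrow> complex) \<Rightarrow> nat \<Rightarrow> (nat \<Rightarrow> nat) \<Rightarrow> complex" where
  "fejer_mean m f n x = (\<Sum>k<n. partial_sum m f k x) / of_nat n"

text \<open>real power of an extended nonnegative real (exponent a > 0 intended; \<infinity>^a = \<infinity>)\<close>
definition ennpow :: "ennreal \<Rightarrow> real \<Rightarrow> ennreal" where
  "ennpow x a = (if x = \<infinity> then \<infinity> else ennreal (enn2real x powr a))"

definition Lp_norm :: "(nat \<Rightarrow> nat) \<Rightarrow> real \<Rightarrow> ((nat \<Rightarrow> nat) \<Rightarrow> ennreal) \<Rightarrow> ennreal" where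
  "Lp_norm m p g = ennpow (\<integral>\<^sup>+ x. ennpow (g x) p \<partial>vilenkin_measure m) (1 / p)"

definition maximal_fn :: "(nat \<Rightarrow> (nat \<Rightarrow> nat) \<Rightarrow> complex) \<Rightarrow> (nat \<Rightarrow> nat) \<Rightarrow> ennreal" where
  "maximal_fn f x = (SUP n. ennreal (norm (f n x)))"

definition Hp_norm :: "(nat \<Rightarrow> nat) \<Rightarrow> real \<Rightarrow> (nat \<Rightarrow> (nat \<Rightarrow> nat) \<Rightarrow> complex) \<Rightarrow> ennreal" where
  "Hp_norm m p f = Lp_norm m p (maximal_fn f)"

end

theory Submission
  imports Defs
begin

text \<open>
  Write \<open>F\<^sub>n = n K\<^sub>n\<close> for the unnormalised Fejer kernel. For \<open>n < M\<^sub>N\<^sub>+\<^sub>1\<close> it is dominated, uniformly in \<open>n\<close>, by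
  a multiple of the sum over \<open>t \<le> A \<le> N\<close> of \<open>M\<^sub>t M\<^sub>A\<close> times the indicator that \<open>x\<close> and \<open>y\<close> agree in all
  coordinates below \<open>A\<close> except possibly the \<open>t\<close>-th one. As this bound does not involve \<open>n\<close>, the
  supremum over \<open>n\<close> may be replaced by a sum over the blocks \<open>M\<^sub>N \<le> n < M\<^sub>N\<^sub>+\<^sub>1\<close>.

  No atomic decomposition is needed. Let \<open>u\<^sub>j\<close> be the running record of \<open>|f\<^sub>0|, |f\<^sub>1|, \<dots>\<close>, updated only when
  the new value at least doubles the old record, and let \<open>h\<^sub>j\<close> be its jumps. Then
  \<open>|f\<^sub>n| \<le> 2 (h\<^sub>0 + \<dots> + h\<^sub>n)\<close>, while the sum of the \<open>h\<^sub>j\<^sup>p\<close> is at most a constant times the \<open>p\<close>-th power of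
  the maximal function because records grow geometrically. Each \<open>h\<^sub>j\<close> depends on \<open>j\<close> coordinates only,
  which gives the reverse Jensen inequality \<open>(E h\<^sub>j)\<^sup>p \<le> M\<^sub>j\<^sup>1\<^sup>-\<^sup>p E h\<^sub>j\<^sup>p\<close>. Subadditivity of the \<open>p\<close>-th power
  reduces everything to geometric sums of powers of \<open>M\<close>, which converge since \<open>2 p < 1\<close>.
\<close>

section \<open>Real inequalities\<close>

text \<open>After division by \<open>a + b\<close> both terms lie in [0, 1], where
  \<open>p \<le> 1\<close> makes the \<open>p\<close>-th power at least as large as the number
  itself; the two fractions add up to 1.\<close>

lemma powr_add_le:
  fixes a b p :: real
  assumes "0 < p" "p \<le> 1" "0 \<le> a" "0 \<le> b"
  shows "(a + b) powr p \<le> a powr p + b powr p"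
proof (cases "a + b = 0")
  case True
  then show ?thesis by simp
next
  case False
  define s where "s = a + b"
  have s: "0 < s" using False assms by (simp add: s_def)
  have *: "c / s * s powr p \<le> c powr p" if "0 \<le> c" "c \<le> s" for c
  proof -
    have "(c / s) powr 1 \<le> (c / s) powr p"
      using powr_mono'[of p 1 "c / s"] that s assms by simp
    then have "c / s * s powr p \<le> (c / s) powr p * s powr p"
      using that s by (intro mult_right_mono) auto
    also have "\<dots> = c powr p"
      using that s by (simp add: powr_divide)
    finally show ?thesis .
  qed
  have "a / s + b / s = 1"
    using s by (simp add: s_def flip: add_divide_distrib)
  then have "s powr p = a / s * s powr p + b / s * s powr p"
    by (metis distrib_right mult_1)
  also have "\<dots> \<le> a powr p + b powr p"
    using assms by (intro add_mono *) (auto simp: s_def)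
  finally show ?thesis by (simp add: s_def)
qed

lemma powr_sum_le:
  fixes p :: real
  assumes "0 < p" "p \<le> 1" "\<And>i. i \<in> I \<Longrightarrow> 0 \<le> a i"
  shows "(\<Sum>i\<in>I. a i) powr p \<le> (\<Sum>i\<in>I. a i powr p)"
  using assms(3)
proof (induction I rule: infinite_finite_induct)
  case (insert i I)
  have "(a i + (\<Sum>i\<in>I. a i)) powr p \<le> a i powr p + (\<Sum>i\<in>I. a i) powr p"
    using insert.prems by (intro powr_add_le assms(1,2) sum_nonneg) auto
  then show ?case using insert by fastforce
qed auto

section \<open>Doubling records and their jumps\<close>

primrec doubling_record :: "(nat \<Rightarrow> real) \<Rightarrow> nat \<Rightarrow> real" where
  "doubling_record a 0 = a 0"
| "doubling_record a (Suc j) = (if 2 * doubling_record a j \<le> a (Suc j) then a (Suc j) else doubling_record a j)"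

primrec doubling_jump :: "(nat \<Rightarrow> real) \<Rightarrow> nat \<Rightarrow> real" where
  "doubling_jump a 0 = a 0"
| "doubling_jump a (Suc j) = doubling_record a (Suc j) - doubling_record a j"

text \<open>The sum of the geometric series with ratio \<open>2 powr - e\<close>, for
  \<open>e > 0\<close>. Its fixed-point equation is exactly the induction step of the geometric
  estimates below.\<close>

definition geom :: "real \<Rightarrow> real" where
  "geom e = 1 / (1 - 2 powr - e)"

lemma geom_fixpoint: "0 < e \<Longrightarrow> 1 + 2 powr - e * geom e = geom e"
proof -
  assume "0 < e"
  then have "2 powr - e < (2::real) powr 0" by (intro powr_less_mono) auto
  moreover have "1 + w * (1 / (1 - w)) = 1 / (1 - w)" if "w < 1" for w :: real
    using that by (simp add: field_simps)
  ultimately show ?thesis by (simp add: geom_def)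
qed

lemma geom_ge1: assumes "0 < e" shows "1 \<le> geom e"
proof -
  have "2 powr - e < (2::real) powr 0" using assms by (intro powr_less_mono) auto
  then show ?thesis by (simp add: geom_def)
qed

lemma sum_doubling_jump: "(\<Sum>j\<le>n. doubling_jump a j) = doubling_record a n"
  by (induction n) simp_all

lemma doubling_record_attained: "\<exists>i\<le>n. doubling_record a n = a i"
proof (induction n)
  case (Suc n)
  then obtain i where "i \<le> n" "doubling_record a n = a i" by blast
  then show ?case by (cases "2 * doubling_record a n \<le> a (Suc n)") (auto intro: exI[of _ i])
qed simp

context
  fixes a :: "nat \<Rightarrow> real"
  assumes a_nonneg: "0 \<le> a j"
begin

lemma doubling_record_nonneg: "0 \<le> doubling_record a n"
  using doubling_record_attained[of n a] a_nonneg by auto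

lemma doubling_jump_nonneg: "0 \<le> doubling_jump a n"
proof (cases n)
  case (Suc k)
  then show ?thesis using doubling_record_nonneg[of k] by simp
qed (simp add: a_nonneg)

text \<open>Either the record has just been set to \<open>a n\<close>, or the update was refused
  because \<open>a n\<close> is less than twice the old record.\<close>

lemma le_doubling_record: "a n \<le> 2 * doubling_record a n"
  using a_nonneg by (cases n) simp_all

text \<open>At an update the old record is at most half the new one, so the bound inherited from it
  shrinks by \<open>2 powr - p\<close> and leaves room for the new jump; without an update the jump
  is 0.\<close>

lemma sum_doubling_jump_powr:
  assumes "0 < p" shows "(\<Sum>j\<le>n. doubling_jump a j powr p) \<le> geom p * doubling_record a n powr p"
proof (induction n)
  case 0
  have "1 * a 0 powr p \<le> geom p * a 0 powr p"
    by (intro mult_right_mono geom_ge1 assms) auto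
  then show ?case by simp
next
  case (Suc n)
  show ?case
  proof (cases "2 * doubling_record a n \<le> a (Suc n)")
    case True
    have "doubling_record a n powr p \<le> (a (Suc n) / 2) powr p"
      using True assms doubling_record_nonneg by (intro powr_mono2) auto
    also have "\<dots> = 2 powr - p * a (Suc n) powr p"
      using a_nonneg by (simp add: powr_divide powr_minus field_simps)
    finally have 1: "doubling_record a n powr p \<le> 2 powr - p * a (Suc n) powr p" .
    have 2: "(a (Suc n) - doubling_record a n) powr p \<le> a (Suc n) powr p"
      using True assms doubling_record_nonneg[of n] a_nonneg[of "Suc n"] by (intro powr_mono2) auto
    have "(\<Sum>j\<le>Suc n. doubling_jump a j powr p) \<le> geom p * doubling_record a n powr p + a (Suc n) powr p"
      using Suc 2 True by simp
    also have "\<dots> \<le> geom p * (2 powr - p * a (Suc n) powr p) + a (Suc n) powr p"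
      using 1 geom_ge1[OF assms] by (intro add_right_mono mult_left_mono) auto
    also have "\<dots> = (1 + 2 powr - p * geom p) * a (Suc n) powr p"
      by (simp add: algebra_simps)
    also have "\<dots> = geom p * doubling_record a (Suc n) powr p"
      using True by (simp only: geom_fixpoint[OF assms] doubling_record.simps if_True)
    finally show ?thesis .
  qed (use Suc in simp)
qed

end

lemma ennpow_ennreal: "0 \<le> r \<Longrightarrow> ennpow (ennreal r) a = ennreal (r powr a)"
  by (simp add: ennpow_def)

lemma ennpow_mono:
  assumes "x \<le> y" "0 \<le> a" shows "ennpow x a \<le> ennpow y a"
proof (cases "y = \<infinity>")
  case False
  then have "x \<noteq> \<infinity>" using assms(1) by (auto simp: top_unique)
  then show ?thesis
    using False assms by (auto simp: ennpow_def less_top intro!: ennreal_leI powr_mono2 enn2real_mono)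
qed (simp add: ennpow_def)

section \<open>Averages over cylinders\<close>

locale vilenkin_group =
  fixes m :: "nat \<Rightarrow> nat" and B :: nat
  assumes m_ge2: "2 \<le> m k" and m_le: "m k \<le> B"
begin

abbreviation "M \<equiv> Mprod m"
definition G :: "(nat \<Rightarrow> nat) set" where "G = {x. \<forall>j. x j < m j}"

text \<open>Measurability with respect to the sigma-algebra whose atoms are the intervals of rank
  \<open>J\<close>. Only points of \<open>G\<close> are compared, since a martingale is constrained
  only there.\<close>

definition depends_on :: "nat \<Rightarrow> ((nat \<Rightarrow> nat) \<Rightarrow> 'a) \<Rightarrow> bool" where
  "depends_on J g \<longleftrightarrow> (\<forall>x\<in>G. \<forall>y\<in>G. (\<forall>j<J. x j = y j) \<longrightarrow> g x = g y)"

text \<open>Each interval \<open>I\<^sub>J(x)\<close> is represented by its point with zero tail; since that point lies in \<open>G\<close>,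
  functions of the first \<open>J\<close> coordinates can be evaluated at it directly.\<close>

definition cyl :: "nat \<Rightarrow> (nat \<Rightarrow> nat) set" where
  "cyl J = {c\<in>G. \<forall>j\<ge>J. c j = 0}"

text \<open>Evaluates \<open>g\<close> at representatives only, so it is the integral of
  \<open>g\<close> once \<open>g\<close> depends on the first \<open>J\<close> coordinates. The open
  value type covers real and complex functions.\<close>

definition av :: "nat \<Rightarrow> ((nat \<Rightarrow> nat) \<Rightarrow> 'a) \<Rightarrow> 'a::real_normed_field" where
  "av J g = (\<Sum>c\<in>cyl J. g c) / of_nat (M J)"

definition trunc :: "nat \<Rightarrow> (nat \<Rightarrow> nat) \<Rightarrow> nat \<Rightarrow> nat" where
  "trunc J x = (\<lambda>j. if j < J then x j else 0)"

section \<open>Elementary properties of \<open>M\<close>, cylinders and averages\<close>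

lemma m_pos [simp]: "0 < m k"
  using m_ge2[of k] by linarith

lemma m_nonzero [simp]: "m k \<noteq> 0"
  using m_pos[of k] by linarith

lemma M_0 [simp]: "M 0 = 1" and M_Suc: "M (Suc k) = m k * M k"
  by (simp_all add: Mprod_def)

lemma M_pos [simp]: "0 < M k"
  by (simp add: Mprod_def prod_pos)

lemma M_nonzero [simp]: "M k \<noteq> 0"
  using M_pos[of k] by linarith

lemma M_Suc_ge: "2 * M k \<le> M (Suc k)"
  using m_ge2[of k] by (simp add: M_Suc)

lemma M_strict_mono: "strict_mono M"
proof (rule strict_monoI_Suc)
  fix k show "M k < M (Suc k)"
    using M_Suc_ge[of k] M_pos[of k] by linarith
qed

lemma M_mono: "j \<le> k \<Longrightarrow> M j \<le> M k"
  using M_strict_mono by (simp add: strict_mono_less_eq)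

lemma less_M: "k < M k"
proof (induction k)
  case (Suc k)
  then show ?case using M_Suc_ge[of k] by linarith
qed simp

lemma depends_onD: "depends_on J g \<Longrightarrow> x \<in> G \<Longrightarrow> y \<in> G \<Longrightarrow> (\<And>j. j < J \<Longrightarrow> x j = y j) \<Longrightarrow> g x = g y"
  unfolding depends_on_def by blast

lemma depends_onI: "(\<And>x y. x \<in> G \<Longrightarrow> y \<in> G \<Longrightarrow> (\<And>j. j < J \<Longrightarrow> x j = y j) \<Longrightarrow> g x = g y) \<Longrightarrow> depends_on J g"
  unfolding depends_on_def by blast

lemma depends_on_mono: "depends_on J g \<Longrightarrow> J \<le> K \<Longrightarrow> depends_on K g"
  unfolding depends_on_def by (meson order_less_le_trans)

lemma depends_on_comp:
  assumes "depends_on J g" shows "depends_on J (\<lambda>x. F (g x))"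
proof (rule depends_onI)
  fix x y assume "x \<in> G" "y \<in> G" "\<And>j. j < J \<Longrightarrow> x j = y j"
  then have "g x = g y" by (rule depends_onD[OF assms])
  then show "F (g x) = F (g y)" by simp
qed

lemma depends_on_comp2:
  assumes "depends_on J g" "depends_on J h" shows "depends_on J (\<lambda>x. F (g x) (h x))"
proof (rule depends_onI)
  fix x y assume *: "x \<in> G" "y \<in> G" "\<And>j. j < J \<Longrightarrow> x j = y j"
  then have "g x = g y" "h x = h y"
    by (auto intro: depends_onD[OF assms(1) *] depends_onD[OF assms(2) *])
  then show "F (g x) (h x) = F (g y) (h y)" by simp
qed

lemma trunc_in_cyl: "x \<in> G \<Longrightarrow> trunc J x \<in> cyl J"
  by (auto simp: trunc_def cyl_def G_def)

lemma cyl_G [intro]: "c \<in> cyl J \<Longrightarrow> c \<in> G"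
  by (simp add: cyl_def)

lemma cyl_0: "cyl 0 = {\<lambda>_. 0}"
  by (auto simp: cyl_def G_def)

text \<open>Points of \<open>cyl J\<close> vanish at position \<open>J\<close>, so the updated point
  determines both \<open>c\<close> and \<open>j\<close>.\<close>

lemma inj_on_fun_upd_cyl: "inj_on (\<lambda>(c, j). c(J := j)) (cyl J \<times> {..<m J})"
proof (rule inj_onI, clarify)
  fix c j c' j' assume c: "c \<in> cyl J" "c' \<in> cyl J" and eq: "c(J := j) = c'(J := j')"
  have "c k = c' k" for k
    using fun_cong[OF eq, of k] c by (cases "k = J") (auto simp: cyl_def)
  moreover have "j = j'" using fun_cong[OF eq, of J] by simp
  ultimately show "c = c' \<and> j = j'" by auto
qed

lemma cyl_Suc: "cyl (Suc J) = (\<lambda>(c, j). c(J := j)) ` (cyl J \<times> {..<m J})"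
proof
  show "cyl (Suc J) \<subseteq> (\<lambda>(c, j). c(J := j)) ` (cyl J \<times> {..<m J})"
  proof
    fix c assume c: "c \<in> cyl (Suc J)"
    then have "c(J := 0) \<in> cyl J" "c J < m J"
      by (auto simp: cyl_def G_def Suc_le_eq)
    then show "c \<in> (\<lambda>(c, j). c(J := j)) ` (cyl J \<times> {..<m J})"
      by (intro image_eqI[of _ _ "(c(J := 0), c J)"]) auto
  qed
qed (auto simp: cyl_def G_def)

lemma finite_cyl [simp]: "finite (cyl J)"
proof (induction J)
  case (Suc J)
  then show ?case unfolding cyl_Suc by (intro finite_imageI finite_cartesian_product) auto
qed (simp add: cyl_0)

lemma sum_cyl_Suc: "(\<Sum>c\<in>cyl (Suc J). g c) = (\<Sum>c\<in>cyl J. \<Sum>j<m J. g (c(J := j)))"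
proof -
  have "(\<Sum>c\<in>cyl (Suc J). g c) = (\<Sum>(c, j)\<in>cyl J \<times> {..<m J}. g (c(J := j)))"
    unfolding cyl_Suc by (subst sum.reindex[OF inj_on_fun_upd_cyl]) (simp add: o_def case_prod_unfold)
  also have "\<dots> = (\<Sum>c\<in>cyl J. \<Sum>j<m J. g (c(J := j)))"
    by (rule sum.cartesian_product[symmetric])
  finally show ?thesis .
qed

text \<open>Each representative splits into \<open>m J\<close> new ones on which \<open>g\<close>
  keeps its value, and the normalisation grows by the same factor.\<close>

lemma av_Suc:
  assumes "depends_on J g" shows "av (Suc J) g = av J g"
proof -
  have "g (c(J := j)) = g c" if "c \<in> cyl J" "j < m J" for c j
    using that by (intro depends_onD[OF assms]) (auto simp: cyl_def G_def)
  then have "(\<Sum>c\<in>cyl (Suc J). g c) = (\<Sum>c\<in>cyl J. of_nat (m J) * g c)"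
    unfolding sum_cyl_Suc by (intro sum.cong refl) simp
  then show ?thesis
    by (simp add: av_def M_Suc flip: sum_distrib_left)
qed

lemma av_eq:
  assumes "depends_on J g" "J \<le> K" shows "av K g = av J g"
  using assms(2)
proof (induction K rule: dec_induct)
  case (step K)
  then show ?case using av_Suc[OF depends_on_mono[OF assms(1)], of K] by simp
qed simp

lemma av_mono: "(\<And>c. c \<in> G \<Longrightarrow> g c \<le> h c) \<Longrightarrow> av J g \<le> (av J h :: real)"
  unfolding av_def by (intro divide_right_mono sum_mono) (auto dest: cyl_G)

lemma av_nonneg: "(\<And>c. c \<in> G \<Longrightarrow> 0 \<le> g c) \<Longrightarrow> 0 \<le> (av J g :: real)"
  unfolding av_def by (intro divide_nonneg_nonneg sum_nonneg) (auto dest: cyl_G)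

lemma av_cmult: "av J (\<lambda>x. a * g x) = a * av J g"
  by (simp add: av_def flip: sum_distrib_left)

lemma av_sum: "av J (\<lambda>x. \<Sum>i\<in>A. g i x) = (\<Sum>i\<in>A. av J (g i))"
  unfolding av_def by (subst sum.swap) (simp add: sum_divide_distrib)

lemma norm_av_le: "norm (av J g) \<le> av J (\<lambda>x. norm (g x))"
  unfolding av_def by (simp add: norm_divide divide_right_mono norm_sum)

lemma av_swap: "av J (\<lambda>x. av K (g x)) = av K (\<lambda>y. av J (\<lambda>x. g x y))"
proof -
  have "(\<Sum>c\<in>cyl J. \<Sum>d\<in>cyl K. g c d) = (\<Sum>d\<in>cyl K. \<Sum>c\<in>cyl J. g c d)"
    by (rule sum.swap)
  then show ?thesis
    by (simp add: av_def flip: sum_divide_distrib)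
qed

section \<open>Haar measure and integrals as finite averages\<close>

abbreviation "\<mu> \<equiv> vilenkin_measure m"

lemma prob_space_uniform: "prob_space (uniform_count_measure {..<m k})"
  by (rule prob_space_uniform_count_measure) (auto simp: lessThan_empty_iff)

sublocale vprod: product_prob_space "\<lambda>k. uniform_count_measure {..<m k}" UNIV
  by (intro product_prob_spaceI prob_space_uniform)

lemma space_mu: "space \<mu> = G"
  by (auto simp: G_def vilenkin_measure_def space_PiM space_uniform_count_measure PiE_def Pi_def)

sublocale prob_space \<mu>
  unfolding vilenkin_measure_def by (rule vprod.P.prob_space_axioms)

definition interval :: "nat \<Rightarrow> (nat \<Rightarrow> nat) \<Rightarrow> (nat \<Rightarrow> nat) set" where
  "interval J c = {x\<in>G. \<forall>j<J. x j = c j}"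

text \<open>Presents an interval as the cylinder over a box of singletons, the form in which the
  product measure can be evaluated.\<close>

lemma interval_eq_prod_emb:
  assumes "c \<in> G"
  shows "interval J c = prod_emb UNIV (\<lambda>k. uniform_count_measure {..<m k}) {..<J} (\<Pi>\<^sub>E j\<in>{..<J}. {c j})"
proof (intro set_eqI iffI)
  fix x assume "x \<in> interval J c"
  then show "x \<in> prod_emb UNIV (\<lambda>k. uniform_count_measure {..<m k}) {..<J} (\<Pi>\<^sub>E j\<in>{..<J}. {c j})"
    by (simp add: interval_def G_def prod_emb_def space_uniform_count_measure PiE_iff)
next
  fix x assume "x \<in> prod_emb UNIV (\<lambda>k. uniform_count_measure {..<m k}) {..<J} (\<Pi>\<^sub>E j\<in>{..<J}. {c j})"
  then show "x \<in> interval J c"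
    by (simp add: interval_def G_def prod_emb_def space_uniform_count_measure PiE_iff)
qed

lemma interval_sets: "c \<in> G \<Longrightarrow> interval J c \<in> sets \<mu>"
  unfolding vilenkin_measure_def
  by (subst interval_eq_prod_emb, assumption, rule sets_PiM_I) (auto simp: G_def sets_uniform_count_measure)

lemma emeasure_interval:
  assumes "c \<in> G" shows "emeasure \<mu> (interval J c) = ennreal (1 / real (M J))"
proof -
  have "emeasure \<mu> (interval J c) = (\<Prod>j<J. emeasure (uniform_count_measure {..<m j}) {c j})"
    unfolding interval_eq_prod_emb[OF assms] vilenkin_measure_def
    by (rule vprod.emeasure_PiM_emb) (use assms in \<open>auto simp: G_def sets_uniform_count_measure\<close>)
  also have "\<dots> = (\<Prod>j<J. ennreal (1 / real (m j)))"
    using assms by (intro prod.cong refl) (simp add: G_def emeasure_uniform_count_measure)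
  also have "\<dots> = ennreal (\<Prod>j<J. 1 / real (m j))"
    by (rule prod_ennreal) simp
  finally show ?thesis by (simp add: Mprod_def prod_dividef)
qed

lemma measure_interval: "c \<in> G \<Longrightarrow> measure \<mu> (interval J c) = 1 / real (M J)"
  by (simp add: measure_def emeasure_interval)

lemma interval_cyl_iff:
  assumes "x \<in> G" "c \<in> cyl J" shows "x \<in> interval J c \<longleftrightarrow> c = trunc J x"
proof
  assume x: "x \<in> interval J c"
  show "c = trunc J x"
  proof
    fix j show "c j = trunc J x j"
      using x assms by (cases "j < J") (simp_all add: interval_def trunc_def cyl_def)
  qed
next
  assume "c = trunc J x"
  then show "x \<in> interval J c" using assms(1) by (simp add: interval_def trunc_def)
qed

text \<open>The intervals of the representatives partition \<open>G\<close>, and \<open>x\<close>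
  lies in that of \<open>trunc J x\<close>. Hence a function of \<open>J\<close> coordinates is a
  finite step function.\<close>

lemma sum_indicator_cyl:
  fixes g :: "_ \<Rightarrow> 'a::semiring_1"
  assumes "x \<in> G" shows "(\<Sum>c\<in>cyl J. g c * indicator (interval J c) x) = g (trunc J x)"
proof -
  have "(\<Sum>c\<in>cyl J. g c * indicator (interval J c) x) = (\<Sum>c\<in>cyl J. if c = trunc J x then g c else 0)"
    by (intro sum.cong refl) (simp add: indicator_def interval_cyl_iff[OF assms])
  then show ?thesis using trunc_in_cyl[OF assms, of J] by simp
qed

lemma depends_on_trunc: "depends_on J g \<Longrightarrow> x \<in> G \<Longrightarrow> g x = g (trunc J x)"
  by (rule depends_onD[of J g x "trunc J x"]) (auto simp: trunc_def G_def)

lemma nn_integral_depends_on: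
  assumes "depends_on J g" "\<And>x. x \<in> G \<Longrightarrow> 0 \<le> g x"
  shows "(\<integral>\<^sup>+x. ennreal (g x) \<partial>\<mu>) = ennreal (av J g)"
    and "(\<lambda>x. ennreal (g x)) \<in> borel_measurable \<mu>"
proof -
  have eq: "ennreal (g x) = (\<Sum>c\<in>cyl J. ennreal (g c) * indicator (interval J c) x)" if "x \<in> space \<mu>" for x
    unfolding sum_indicator_cyl[OF that[unfolded space_mu]]
    using that depends_on_trunc[OF assms(1), of x] by (simp add: space_mu)
  have meas: "(\<lambda>x. ennreal (g c) * indicator (interval J c) x) \<in> borel_measurable \<mu>" if "c \<in> cyl J" for c
    using interval_sets[of c J] cyl_G[OF that] by auto
  show "(\<lambda>x. ennreal (g x)) \<in> borel_measurable \<mu>"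
    by (subst measurable_cong[OF eq], assumption, rule borel_measurable_sum, rule meas)
  have "(\<integral>\<^sup>+x. ennreal (g x) \<partial>\<mu>) = (\<integral>\<^sup>+x. (\<Sum>c\<in>cyl J. ennreal (g c) * indicator (interval J c) x) \<partial>\<mu>)"
    by (intro nn_integral_cong eq)
  also have "\<dots> = (\<Sum>c\<in>cyl J. \<integral>\<^sup>+x. ennreal (g c) * indicator (interval J c) x \<partial>\<mu>)"
    by (rule nn_integral_sum) (rule meas)
  also have "\<dots> = (\<Sum>c\<in>cyl J. ennreal (g c / real (M J)))"
  proof (intro sum.cong refl)
    fix c assume "c \<in> cyl J"
    then have c: "c \<in> G" by (rule cyl_G)
    have "(\<integral>\<^sup>+x. ennreal (g c) * indicator (interval J c) x \<partial>\<mu>) = ennreal (g c) * ennreal (1 / real (M J))"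
      using interval_sets[OF c] by (simp add: nn_integral_cmult_indicator emeasure_interval[OF c])
    also have "\<dots> = ennreal (g c / real (M J))"
      using assms(2)[OF c] by (simp flip: ennreal_mult)
    finally show "(\<integral>\<^sup>+x. ennreal (g c) * indicator (interval J c) x \<partial>\<mu>) = ennreal (g c / real (M J))" .
  qed
  also have "\<dots> = ennreal (av J g)"
    by (subst sum_ennreal) (auto intro!: divide_nonneg_nonneg assms(2) simp: av_def sum_divide_distrib)
  finally show "(\<integral>\<^sup>+x. ennreal (g x) \<partial>\<mu>) = ennreal (av J g)" .
qed

lemma integral_depends_on:
  fixes g :: "_ \<Rightarrow> complex"
  assumes "depends_on J g"
  shows "integral\<^sup>L \<mu> g = av J g"
proof -
  have "integral\<^sup>L \<mu> g = integral\<^sup>L \<mu> (\<lambda>x. \<Sum>c\<in>cyl J. g c * indicator (interval J c) x)"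
    by (intro Bochner_Integration.integral_cong refl, subst sum_indicator_cyl)
      (simp_all only: space_mu depends_on_trunc[OF assms])
  also have "\<dots> = (\<Sum>c\<in>cyl J. integral\<^sup>L \<mu> (\<lambda>x. indicat_real (interval J c) x *\<^sub>R g c))"
  proof (subst Bochner_Integration.integral_sum)
    fix c assume "c \<in> cyl J"
    then have "interval J c \<in> sets \<mu>" by (intro interval_sets cyl_G)
    then have "integrable \<mu> (\<lambda>x. indicat_real (interval J c) x *\<^sub>R g c)"
      by (intro integrable_scaleR_left integrable_real_indicator) (auto simp: emeasure_eq_measure)
    then show "integrable \<mu> (\<lambda>x. g c * indicator (interval J c) x)"
      by (rule Bochner_Integration.integrable_cong[THEN iffD1, rotated -1]) (auto simp: indicator_def)
  qed (intro sum.cong Bochner_Integration.integral_cong refl, auto simp: indicator_def)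
  also have "\<dots> = av J g"
    unfolding av_def sum_divide_distrib
  proof (intro sum.cong refl)
    fix c assume "c \<in> cyl J"
    then have c: "c \<in> G" by (rule cyl_G)
    have "interval J c \<inter> space \<mu> = interval J c" by (auto simp: space_mu interval_def)
    then show "integral\<^sup>L \<mu> (\<lambda>x. indicat_real (interval J c) x *\<^sub>R g c) = g c / of_nat (M J)"
      using interval_sets[OF c, of J] emeasure_interval[OF c, of J]
      by (simp add: measure_interval[OF c] scaleR_conv_of_real field_simps)
  qed
  finally show ?thesis .
qed

section \<open>Dirichlet and Fejer kernels\<close>


text \<open>The Vilenkin character with the Rademacher values replaced by arbitrary numbers
  \<open>z k\<close>. Inserting \<open>ratio x y\<close> later gives the convolution kernels without
  introducing subtraction on \<open>G\<close>.\<close>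

definition chi :: "(nat \<Rightarrow> complex) \<Rightarrow> nat \<Rightarrow> complex" where
  "chi z i = (\<Prod>k<i. z k ^ digit m i k)"

lemma digit_eq_0: "i < M k \<Longrightarrow> digit m i k = 0"
  by (simp add: digit_def)

text \<open>Digits vanish at every position \<open>k\<close> with \<open>i < M k\<close>, so all
  products that reach far enough agree; the defining product does by \<open>less_M\<close>.\<close>

lemma chi_eq:
  assumes "i < M A" shows "chi z i = (\<Prod>k<A. z k ^ digit m i k)"
proof -
  have *: "(\<Prod>k<max i A. z k ^ digit m i k) = (\<Prod>k<K. z k ^ digit m i k)"
    if K: "i < M K" "K \<le> max i A" for K
  proof (intro prod.mono_neutral_right ballI)
    fix k assume "k \<in> {..<max i A} - {..<K}"
    then have "M K \<le> M k" by (intro M_mono) auto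
    then show "z k ^ digit m i k = 1"
      using K(1) by (subst digit_eq_0) auto
  qed (use K(2) in auto)
  show ?thesis
    using *[of i] *[of A] assms less_M[of i] by (simp add: chi_def)
qed

text \<open>\<open>M A\<close> is a multiple of \<open>M (Suc k)\<close>, so adding
  \<open>s * M A\<close> changes the quotient by \<open>M k\<close> by a multiple of
  \<open>m k\<close>.\<close>

lemma digit_add_lower:
  assumes "k < A" shows "digit m (s * M A + i) k = digit m i k"
proof -
  have "M (Suc k) dvd M A"
    unfolding Mprod_def by (rule prod_dvd_prod_subset) (use assms in auto)
  then obtain Q where Q: "M A = M k * (m k * Q)"
    by (auto simp: M_Suc mult_ac elim: dvdE)
  have "(s * M A + i) div M k = (i + M k * (s * m k * Q)) div M k"
    by (simp add: Q mult_ac add.commute)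
  also have "\<dots> = i div M k + m k * (s * Q)"
    by (subst div_mult_self2) (simp_all add: mult_ac)
  finally show ?thesis by (simp add: digit_def)
qed

lemma digit_add_top:
  assumes "i < M A" "s < m A" shows "digit m (s * M A + i) A = s"
  using assms by (simp add: digit_def)

lemma chi_split:
  assumes "i < M A" "s < m A" shows "chi z (s * M A + i) = z A ^ s * chi z i"
proof -
  have "s * M A + i < Suc s * M A" using assms(1) by simp
  also have "\<dots> \<le> M (Suc A)" using assms(2) unfolding M_Suc by (intro mult_right_mono) auto
  finally have "chi z (s * M A + i) = (\<Prod>k<Suc A. z k ^ digit m (s * M A + i) k)"
    by (rule chi_eq)
  also have "\<dots> = z A ^ s * (\<Prod>k<A. z k ^ digit m i k)"
    using assms by (simp add: digit_add_lower digit_add_top)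
  also have "(\<Prod>k<A. z k ^ digit m i k) = chi z i"
    using chi_eq[OF assms(1)] by simp
  finally show ?thesis .
qed

section \<open>Splitting the kernels at the leading digit\<close>

definition dirichlet :: "(nat \<Rightarrow> complex) \<Rightarrow> nat \<Rightarrow> complex" where
  "dirichlet z n = (\<Sum>i<n. chi z i)"

definition fejer_sum :: "(nat \<Rightarrow> complex) \<Rightarrow> nat \<Rightarrow> complex" where
  "fejer_sum z n = (\<Sum>k<n. dirichlet z k)"

lemma sum_lessThan_add: "(\<Sum>i<a + b. g i) = (\<Sum>i<a. g i) + (\<Sum>i<b. (g (a + i) :: complex))" for a b :: nat
  by (induction b) (simp_all add: add.assoc)

lemma dirichlet_add:
  assumes "k \<le> M A" "s < m A" shows "dirichlet z (s * M A + k) = dirichlet z (s * M A) + z A ^ s * dirichlet z k"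
  unfolding dirichlet_def sum_lessThan_add sum_distrib_left
  using assms by (intro arg_cong2[where f = "(+)"] refl sum.cong) (simp add: chi_split)

text \<open>Sums \<open>dirichlet_add\<close> over the last \<open>k\<close> indices. The case
  \<open>k = M A\<close> is included so that full blocks can be chained in
  \<open>fejer_sum_mult\<close>.\<close>

lemma fejer_sum_add:
  assumes "k \<le> M A" "s < m A"
  shows "fejer_sum z (s * M A + k) = fejer_sum z (s * M A) + of_nat k * dirichlet z (s * M A) + z A ^ s * fejer_sum z k"
proof -
  have "(\<Sum>i<k. dirichlet z (s * M A + i)) = (\<Sum>i<k. dirichlet z (s * M A) + z A ^ s * dirichlet z i)"
    using assms by (intro sum.cong refl dirichlet_add) auto
  then show ?thesis
    by (simp add: fejer_sum_def sum_lessThan_add sum.distrib sum_distrib_left)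
qed

lemma dirichlet_mult:
  assumes "s \<le> m A" shows "dirichlet z (s * M A) = (\<Sum>u<s. z A ^ u) * dirichlet z (M A)"
  using assms
proof (induction s)
  case 0 then show ?case by (simp add: dirichlet_def)
next
  case (Suc s)
  then have "dirichlet z (Suc s * M A) = dirichlet z (s * M A) + z A ^ s * dirichlet z (M A)"
    using dirichlet_add[of "M A" A s z] by (simp add: add.commute)
  then show ?case using Suc by (simp add: algebra_simps)
qed

lemma fejer_sum_mult:
  assumes "s \<le> m A"
  shows "fejer_sum z (s * M A) = of_nat (M A) * (\<Sum>u<s. dirichlet z (u * M A)) + (\<Sum>u<s. z A ^ u) * fejer_sum z (M A)"
  using assms
proof (induction s)
  case 0 then show ?case by (simp add: fejer_sum_def)
next
  case (Suc s)
  then have "fejer_sum z (Suc s * M A) = fejer_sum z (s * M A) + of_nat (M A) * dirichlet z (s * M A) + z A ^ s * fejer_sum z (M A)"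
    using fejer_sum_add[of "M A" A s z] by (simp add: add.commute)
  then show ?case using Suc by (simp add: algebra_simps)
qed

text \<open>For \<open>t \<ge> A\<close> no position is exempt, so \<open>agree z A A\<close> tests
  all positions below \<open>A\<close>.\<close>

definition agree :: "(nat \<Rightarrow> complex) \<Rightarrow> nat \<Rightarrow> nat \<Rightarrow> real" where
  "agree z A t = (if \<forall>j<A. j \<noteq> t \<longrightarrow> z j = 1 then 1 else 0)"

lemma agree_nonneg: "0 \<le> agree z A t"
  by (simp add: agree_def)

section \<open>Pointwise kernel bounds at roots of unity\<close>

context
  fixes z :: "nat \<Rightarrow> complex"
  assumes root: "z k ^ m k = 1"
begin

lemma norm_z: "norm (z k) = 1"
proof (rule power_eq_imp_eq_base)
  show "norm (z k) ^ m k = 1 ^ m k"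
    using root[of k] by (simp flip: norm_power)
qed auto

lemma norm_geometric_le: "norm (\<Sum>u<s. z k ^ u) \<le> real s"
  using norm_sum[of "\<lambda>u. z k ^ u" "{..<s}"] by (simp add: norm_power norm_z)

lemma geometric_root: "(\<Sum>u<m k. z k ^ u) = (if z k = 1 then of_nat (m k) else 0)"
  using root[of k] by (simp add: geometric_sum)

text \<open>Paley's formula. Passing from \<open>A\<close> to \<open>Suc A\<close> multiplies by a
  complete geometric sum, which is \<open>m A\<close> if \<open>z A = 1\<close> and 0
  otherwise.\<close>

lemma dirichlet_M: "dirichlet z (M A) = of_nat (M A) * of_real (agree z A A)"
proof (induction A)
  case 0 then show ?case by (simp add: dirichlet_def chi_def agree_def)
next
  case (Suc A)
  have "agree z (Suc A) (Suc A) = (if z A = 1 then agree z A A else 0)"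
    by (auto simp: agree_def less_Suc_eq)
  then show ?case
    using dirichlet_mult[of "m A" A z] Suc by (simp add: M_Suc geometric_root)
qed

lemma norm_dirichlet_mult_le:
  assumes "s \<le> m A" shows "norm (dirichlet z (s * M A)) \<le> real B * real (M A) * agree z A A"
proof -
  have "norm (dirichlet z (s * M A)) = norm (\<Sum>u<s. z A ^ u) * (real (M A) * agree z A A)"
    by (simp add: dirichlet_mult[OF assms] dirichlet_M norm_mult agree_nonneg)
  also have "\<dots> \<le> real B * (real (M A) * agree z A A)"
    using assms m_le[of A] norm_geometric_le[where s = s and k = A]
    by (intro mult_right_mono) (auto simp: agree_nonneg)
  finally show ?thesis by (simp add: mult.assoc)
qed

lemma norm_sum_dirichlet_le:
  assumes "s \<le> m A"
  shows "norm (of_nat (M A) * (\<Sum>u<s. dirichlet z (u * M A))) \<le> real s * (real B * real (M A) * real (M A) * agree z A A)"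
proof -
  have "norm (\<Sum>u<s. dirichlet z (u * M A)) \<le> (\<Sum>u<s. real B * real (M A) * agree z A A)"
    using assms by (intro order.trans[OF norm_sum] sum_mono norm_dirichlet_mult_le) auto
  then have "real (M A) * norm (\<Sum>u<s. dirichlet z (u * M A)) \<le> real (M A) * (\<Sum>u<s. real B * real (M A) * agree z A A)"
    by (intro mult_left_mono) auto
  then show ?thesis by (simp add: norm_mult mult_ac)
qed

text \<open>In the recursion of \<open>fejer_sum_mult\<close> the Dirichlet part does not test
  \<open>z A\<close> and supplies the new term \<open>t = A\<close>. The other part vanishes unless
  \<open>z A = 1\<close>, and then its factor \<open>m A\<close> raises \<open>M A\<close> to
  \<open>M (Suc A)\<close> in the old terms.\<close>

lemma norm_fejer_sum_M_le:
  "norm (fejer_sum z (M A)) \<le> real B * (\<Sum>t<A. real (M t) * real (M A) * agree z A t)"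
proof (induction A)
  case 0 then show ?case by (simp add: fejer_sum_def dirichlet_def)
next
  case (Suc A)
  have 1: "agree z (Suc A) A = agree z A A"
    by (auto simp: agree_def less_Suc_eq)
  have 2: "agree z (Suc A) t = (if z A = 1 then agree z A t else 0)" if "t < A" for t
    using that by (auto simp: agree_def less_Suc_eq)
  have "norm (fejer_sum z (M (Suc A))) \<le> norm (of_nat (M A) * (\<Sum>u<m A. dirichlet z (u * M A))) + norm ((\<Sum>u<m A. z A ^ u) * fejer_sum z (M A))"
    using fejer_sum_mult[of "m A" A z] norm_triangle_ineq by (simp add: M_Suc)
  also have "\<dots> \<le> real (m A) * (real B * real (M A) * real (M A) * agree z A A)
      + real B * (\<Sum>t<A. real (M t) * real (M (Suc A)) * agree z (Suc A) t)"
  proof (rule add_mono)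
    show "norm ((\<Sum>u<m A. z A ^ u) * fejer_sum z (M A)) \<le> real B * (\<Sum>t<A. real (M t) * real (M (Suc A)) * agree z (Suc A) t)"
    proof (cases "z A = 1")
      case True
      have "real (m A) * norm (fejer_sum z (M A)) \<le> real (m A) * (real B * (\<Sum>t<A. real (M t) * real (M A) * agree z A t))"
        by (intro mult_left_mono Suc) auto
      also have "\<dots> = real B * (\<Sum>t<A. real (M t) * real (M (Suc A)) * agree z (Suc A) t)"
        using True by (simp add: 2 M_Suc sum_distrib_left mult_ac)
      finally show ?thesis using True by (simp add: norm_mult)
    qed (simp add: geometric_root sum_nonneg agree_nonneg)
  qed (rule norm_sum_dirichlet_le, simp)
  also have "\<dots> = real B * (\<Sum>t<Suc A. real (M t) * real (M (Suc A)) * agree z (Suc A) t)"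
    by (simp add: 1 M_Suc algebra_simps)
  finally show ?case .
qed

text \<open>Writing \<open>n = s * M A + k\<close>, the full blocks and the term with factor
  \<open>k\<close> pay for the layer \<open>A\<close>; the remainder \<open>k < M A\<close> is
  covered by induction.\<close>

lemma norm_fejer_sum_le:
  assumes "n < M K"
  shows "norm (fejer_sum z n) \<le> (real B)\<^sup>2 * (\<Sum>A<K. \<Sum>t\<le>A. real (M t) * real (M A) * agree z A t)"
  using assms
proof (induction K arbitrary: n)
  case 0 then show ?case by (simp add: fejer_sum_def)
next
  case (Suc A)
  define s k where "s = n div M A" and "k = n mod M A"
  have n: "n = s * M A + k" by (simp only: s_def k_def div_mult_mod_eq)
  have s: "s < m A" using Suc.prems by (simp add: s_def M_Suc less_mult_imp_div_less)
  have k: "k < M A" by (simp add: k_def)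
  define a where "a = real (M A) * real (M A) * agree z A A"
  define b where "b = (\<Sum>t<A. real (M t) * real (M A) * agree z A t)"
  have a: "0 \<le> a" and b: "0 \<le> b"
    by (simp_all add: a_def b_def agree_nonneg sum_nonneg)
  \<comment> \<open>As \<open>s < m A \<le> B\<close>, the two contributions of \<open>a\<close>,
    with factors \<open>s\<close> and 1, together stay within the single factor
    \<open>B\<close>.\<close>
  have s': "real s + 1 \<le> real B" using s m_le[of A] by linarith
  have "fejer_sum z n = of_nat (M A) * (\<Sum>u<s. dirichlet z (u * M A)) + (\<Sum>u<s. z A ^ u) * fejer_sum z (M A)
      + of_nat k * dirichlet z (s * M A) + z A ^ s * fejer_sum z k"
    using s k by (simp add: n fejer_sum_add fejer_sum_mult)
  then have "norm (fejer_sum z n) \<le> norm (of_nat (M A) * (\<Sum>u<s. dirichlet z (u * M A)))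
      + norm ((\<Sum>u<s. z A ^ u) * fejer_sum z (M A)) + norm (of_nat k * dirichlet z (s * M A)) + norm (z A ^ s * fejer_sum z k)"
    by (smt (verit) norm_triangle_ineq)
  \<comment> \<open>In the last sum the upper limit is the outer \<open>A\<close>; the summation
    index only shadows it.\<close>
  also have "\<dots> \<le> real s * (real B * a) + real B * (real B * b) + real B * a
      + (real B)\<^sup>2 * (\<Sum>A<A. \<Sum>t\<le>A. real (M t) * real (M A) * agree z A t)"
  proof (intro add_mono)
    show "norm (of_nat (M A) * (\<Sum>u<s. dirichlet z (u * M A))) \<le> real s * (real B * a)"
      using norm_sum_dirichlet_le[of s A] s by (simp add: a_def mult_ac)
    have "norm (\<Sum>u<s. z A ^ u) * norm (fejer_sum z (M A)) \<le> real B * (real B * b)"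
      using norm_geometric_le[where s = s and k = A] s' norm_fejer_sum_M_le[of A] unfolding b_def by (intro mult_mono) auto
    then show "norm ((\<Sum>u<s. z A ^ u) * fejer_sum z (M A)) \<le> real B * (real B * b)"
      by (simp add: norm_mult)
    have "real k * norm (dirichlet z (s * M A)) \<le> real (M A) * (real B * real (M A) * agree z A A)"
      using k s norm_dirichlet_mult_le[of s A] by (intro mult_mono) auto
    then show "norm (of_nat k * dirichlet z (s * M A)) \<le> real B * a"
      by (simp add: norm_mult a_def mult_ac)
    show "norm (z A ^ s * fejer_sum z k) \<le> (real B)\<^sup>2 * (\<Sum>A<A. \<Sum>t\<le>A. real (M t) * real (M A) * agree z A t)"
      using Suc.IH[OF k] by (simp add: norm_mult norm_power norm_z)
  qed
  also have "real s * (real B * a) + real B * (real B * b) + real B * a = (real s + 1) * (real B * a) + (real B)\<^sup>2 * b"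
    by (simp add: algebra_simps power2_eq_square)
  also have "(real s + 1) * (real B * a) \<le> real B * (real B * a)"
    using s' a by (intro mult_right_mono) auto
  also have "real B * (real B * a) + (real B)\<^sup>2 * b = (real B)\<^sup>2 * (\<Sum>t\<le>A. real (M t) * real (M A) * agree z A t)"
    by (simp add: a_def b_def power2_eq_square algebra_simps flip: lessThan_Suc_atMost)
  finally show ?case by (simp add: algebra_simps)
qed

end

section \<open>Fejer means of martingales\<close>

text \<open>The Rademacher function \<open>r_k\<close> evaluated at the group difference of
  \<open>x\<close> and \<open>y\<close>.\<close>

definition ratio :: "(nat \<Rightarrow> nat) \<Rightarrow> (nat \<Rightarrow> nat) \<Rightarrow> nat \<Rightarrow> complex" where
  "ratio x y k = rademacher m k x * cnj (rademacher m k y)"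

definition matches :: "nat \<Rightarrow> nat \<Rightarrow> (nat \<Rightarrow> nat) \<Rightarrow> (nat \<Rightarrow> nat) \<Rightarrow> real" where
  "matches A t x y = (if \<forall>j<A. j \<noteq> t \<longrightarrow> x j = y j then 1 else 0)"

lemma ratio_cis: "ratio x y k = cis (2 * pi * (real (x k) - real (y k)) / real (m k))"
  by (simp add: ratio_def rademacher_def cis_cnj cis_mult diff_divide_distrib right_diff_distrib)

lemma ratio_root: "ratio x y k ^ m k = 1"
proof -
  have "ratio x y k ^ m k = cis (2 * pi * of_int (int (x k) - int (y k)))"
  proof -
    have "ratio x y k ^ m k = cis (real (m k) * (2 * pi * (real (x k) - real (y k)) / real (m k)))"
      unfolding ratio_cis by (rule Complex.DeMoivre)
    also have "real (m k) * (2 * pi * (real (x k) - real (y k)) / real (m k)) = 2 * pi * of_int (int (x k) - int (y k))"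
      by simp
    finally show ?thesis .
  qed
  then show ?thesis by (simp only: cis_multiple_2pi Ints_of_int)
qed

text \<open>A ratio equal to 1 makes \<open>x k - y k\<close> a multiple of \<open>m k\<close>, and
  its absolute value is below \<open>m k\<close>.\<close>

lemma ratio_eq_1_iff:
  assumes "x \<in> G" "y \<in> G" shows "ratio x y k = 1 \<longleftrightarrow> x k = y k"
proof
  assume "ratio x y k = 1"
  then have "cos (2 * pi * (real (x k) - real (y k)) / real (m k)) = 1"
    by (simp add: ratio_cis complex_eq_iff)
  then obtain q :: int where "2 * pi * (real (x k) - real (y k)) / real (m k) = of_int q * 2 * pi"
    using cos_one_2pi_int by blast
  then have "(2 * pi) * (real (x k) - real (y k)) = (2 * pi) * (of_int q * real (m k))"
    by (simp add: field_simps)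
  then have "real (x k) - real (y k) = of_int q * real (m k)"
    by (simp only: mult_cancel_left) simp
  then have q: "int (x k) - int (y k) = q * int (m k)"
    by (simp flip: of_int_eq_iff[where 'a = real])
  have "x k < m k" "y k < m k" using assms by (auto simp: G_def)
  then have "\<bar>q * int (m k)\<bar> < int (m k)" unfolding q[symmetric] by linarith
  then have "q = 0" by (simp add: abs_mult)
  then show "x k = y k" using q by simp
qed (simp add: ratio_cis)

lemma agree_ratio: "x \<in> G \<Longrightarrow> y \<in> G \<Longrightarrow> agree (ratio x y) A t = matches A t x y"
  by (simp add: agree_def matches_def ratio_eq_1_iff)

lemma vilenkin_chi: "vilenkin m n x = chi (\<lambda>k. rademacher m k x) n"
  by (simp add: vilenkin_def chi_def)

lemma chi_ratio: "vilenkin m n x * cnj (vilenkin m n y) = chi (ratio x y) n"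
  by (simp add: vilenkin_def chi_def ratio_def power_mult_distrib prod.distrib)

lemma depends_on_vilenkin: "i < M J \<Longrightarrow> depends_on J (vilenkin m i)"
  by (rule depends_onI) (simp add: vilenkin_chi chi_eq rademacher_def)

section \<open>Fourier coefficients, partial sums and Fejer means as averages\<close>

lemma vmartingale_depends_on: "vmartingale m f \<Longrightarrow> depends_on n (f n)"
  unfolding vmartingale_def space_mu depends_on_def by blast

text \<open>Average over coordinate \<open>J\<close> first: \<open>w\<close> does not see it, and
  the martingale identity turns the mean of \<open>f (Suc J)\<close> into
  \<open>f J\<close>.\<close>

lemma vmartingale_av:
  assumes "vmartingale m f" "depends_on J w"
  shows "av (Suc J) (\<lambda>x. f (Suc J) x * w x) = av J (\<lambda>x. f J x * w x)"
proof -
  have "(\<Sum>j<m J. f (Suc J) (c(J := j)) * w (c(J := j))) = of_nat (m J) * (f J c * w c)" if c: "c \<in> cyl J" for c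
  proof -
    have "w (c(J := j)) = w c" if "j < m J" for j
      by (rule depends_onD[OF assms(2)]) (use c that in \<open>auto simp: cyl_def G_def\<close>)
    then have "(\<Sum>j<m J. f (Suc J) (c(J := j)) * w (c(J := j))) = (\<Sum>j<m J. f (Suc J) (c(J := j))) * w c"
      by (simp add: sum_distrib_right)
    moreover have "f J c = (\<Sum>j<m J. f (Suc J) (c(J := j))) / of_nat (m J)"
      using assms(1) cyl_G[OF c] unfolding vmartingale_def space_mu by blast
    then have "of_nat (m J) * f J c = (\<Sum>j<m J. f (Suc J) (c(J := j)))"
      by simp
    ultimately show ?thesis by (simp flip: mult.assoc)
  qed
  then show ?thesis
    by (simp add: av_def sum_cyl_Suc M_Suc flip: sum_distrib_left)
qed

text \<open>By the martingale property the integrals under the limit are constant from index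
  \<open>L\<close> on.\<close>

lemma fourier_coeff_eq:
  assumes f: "vmartingale m f" and i: "i < M L"
  shows "fourier_coeff m f i = av L (\<lambda>x. f L x * cnj (vilenkin m i x))"
proof -
  have dep: "depends_on k (\<lambda>x. cnj (vilenkin m i x))" if "L \<le> k" for k
    by (intro depends_on_comp[where F = cnj] depends_on_mono[OF depends_on_vilenkin[OF i] that])
  have "integral\<^sup>L \<mu> (\<lambda>x. f k x * cnj (vilenkin m i x)) = av k (\<lambda>x. f k x * cnj (vilenkin m i x))"
    if "L \<le> k" for k
    by (intro integral_depends_on depends_on_comp2[where F = "(*)"] dep vmartingale_depends_on[OF f] that)
  moreover have "av k (\<lambda>x. f k x * cnj (vilenkin m i x)) = av L (\<lambda>x. f L x * cnj (vilenkin m i x))"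
    if "L \<le> k" for k
    using that
  proof (induction k rule: dec_induct)
    case (step k)
    then show ?case using vmartingale_av[OF f dep[OF step(1)]] by (simp only:)
  qed simp
  ultimately have ev: "\<forall>\<^sub>F k in sequentially. integral\<^sup>L \<mu> (\<lambda>x. f k x * cnj (vilenkin m i x))
      = av L (\<lambda>x. f L x * cnj (vilenkin m i x))"
    by (intro eventually_sequentiallyI[of L]) (rule trans)
  show ?thesis
    unfolding fourier_coeff_def by (rule limI) (rule tendsto_eventually[OF ev])
qed

lemma partial_sum_eq:
  assumes f: "vmartingale m f" and k: "k \<le> M L"
  shows "partial_sum m f k x = av L (\<lambda>y. f L y * dirichlet (ratio x y) k)"
proof -
  have "partial_sum m f k x = (\<Sum>i<k. av L (\<lambda>y. f L y * chi (ratio x y) i))"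
    unfolding partial_sum_def
    using k by (intro sum.cong refl)
      (simp add: fourier_coeff_eq[OF f, of _ L] mult.commute[of _ "vilenkin m _ x"] mult.left_commute
        flip: av_cmult chi_ratio)
  then show ?thesis by (simp add: dirichlet_def sum_distrib_left av_sum)
qed

text \<open>Convolution with the unnormalised kernel, whence the factor \<open>n\<close> on the
  left. The right-hand side no longer involves \<open>n\<close>, only the level
  \<open>L\<close>.\<close>

lemma norm_fejer_mean_le:
  assumes f: "vmartingale m f" and n: "n < M L" and x: "x \<in> G"
  shows "real n * norm (fejer_mean m f n x)
    \<le> (real B)\<^sup>2 * (\<Sum>A<L. \<Sum>t\<le>A. real (M t) * real (M A) * av L (\<lambda>y. norm (f L y) * matches A t x y))"
proof -
  have "(\<Sum>k<n. partial_sum m f k x) = (\<Sum>k<n. av L (\<lambda>y. f L y * dirichlet (ratio x y) k))"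
    using n by (intro sum.cong refl partial_sum_eq[OF f]) auto
  also have "\<dots> = av L (\<lambda>y. f L y * fejer_sum (ratio x y) n)"
    by (simp add: fejer_sum_def sum_distrib_left av_sum)
  finally have "real n * norm (fejer_mean m f n x) \<le> norm (av L (\<lambda>y. f L y * fejer_sum (ratio x y) n))"
    by (simp add: fejer_mean_def norm_divide)
  also have "\<dots> \<le> av L (\<lambda>y. norm (f L y * fejer_sum (ratio x y) n))"
    by (rule norm_av_le)
  also have "\<dots> \<le> av L (\<lambda>y. (real B)\<^sup>2 * (\<Sum>A<L. \<Sum>t\<le>A. real (M t) * real (M A) * (norm (f L y) * matches A t x y)))"
  proof (rule av_mono)
    fix y assume y: "y \<in> G"
    have "norm (f L y) * norm (fejer_sum (ratio x y) n)
      \<le> norm (f L y) * ((real B)\<^sup>2 * (\<Sum>A<L. \<Sum>t\<le>A. real (M t) * real (M A) * matches A t x y))"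
      using norm_fejer_sum_le[where z = "ratio x y", OF ratio_root n]
      by (intro mult_left_mono) (auto simp: agree_ratio[OF x y])
    then show "norm (f L y * fejer_sum (ratio x y) n)
      \<le> (real B)\<^sup>2 * (\<Sum>A<L. \<Sum>t\<le>A. real (M t) * real (M A) * (norm (f L y) * matches A t x y))"
      by (simp add: norm_mult sum_distrib_left mult_ac)
  qed
  also have "\<dots> = (real B)\<^sup>2 * (\<Sum>A<L. \<Sum>t\<le>A. real (M t) * real (M A) * av L (\<lambda>y. norm (f L y) * matches A t x y))"
    by (simp add: av_cmult av_sum)
  finally show ?thesis .
qed

section \<open>Reverse Jensen inequality and geometric sums\<close>


text \<open>\<open>M\<close> at least doubles at each step, so a sum of positive powers is
  controlled by its last term.\<close>

lemma sum_M_powr_le: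
  assumes "0 < e" shows "(\<Sum>A\<le>N. real (M A) powr e) \<le> geom e * real (M N) powr e"
proof (induction N)
  case 0 then show ?case using geom_ge1[OF assms] by simp
next
  case (Suc N)
  have "real (M N) powr e \<le> (real (M (Suc N)) / 2) powr e"
    using M_Suc_ge[of N] assms by (intro powr_mono2) auto
  also have "\<dots> = 2 powr - e * real (M (Suc N)) powr e"
    by (simp add: powr_divide powr_minus field_simps)
  finally have 1: "real (M N) powr e \<le> 2 powr - e * real (M (Suc N)) powr e" .
  have "(\<Sum>A\<le>Suc N. real (M A) powr e) \<le> geom e * real (M N) powr e + real (M (Suc N)) powr e"
    using Suc by simp
  also have "\<dots> \<le> geom e * (2 powr - e * real (M (Suc N)) powr e) + real (M (Suc N)) powr e"
    using 1 geom_ge1[OF assms] by (intro add_right_mono mult_left_mono) auto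
  also have "\<dots> = (1 + 2 powr - e * geom e) * real (M (Suc N)) powr e"
    by (simp add: algebra_simps)
  finally show ?case by (simp only: geom_fixpoint[OF assms])
qed

text \<open>Negative powers are controlled by the first term, so the induction peels off that term
  and moves the start \<open>j\<close>.\<close>

lemma sum_M_powr_minus_le:
  assumes "0 < e" shows "(\<Sum>N\<in>{j..<j + n}. real (M N) powr - e) \<le> geom e * real (M j) powr - e"
proof (induction n arbitrary: j)
  case 0 then show ?case using geom_ge1[OF assms] by simp
next
  case (Suc n)
  have "real (M (Suc j)) powr - e \<le> (2 * real (M j)) powr - e"
    using M_Suc_ge[of j] assms by (intro powr_mono2') auto
  also have "\<dots> = 2 powr - e * real (M j) powr - e"
    by (simp add: powr_mult)
  finally have 1: "real (M (Suc j)) powr - e \<le> 2 powr - e * real (M j) powr - e" .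
  have "(\<Sum>N\<in>{j..<j + Suc n}. real (M N) powr - e)
      = real (M j) powr - e + (\<Sum>N\<in>{Suc j..<Suc j + n}. real (M N) powr - e)"
    by (subst sum.atLeast_Suc_lessThan) simp_all
  also have "\<dots> \<le> real (M j) powr - e + geom e * (2 powr - e * real (M j) powr - e)"
    using 1 geom_ge1[OF assms] by (intro add_left_mono order.trans[OF Suc.IH] mult_left_mono) auto
  also have "\<dots> = (1 + 2 powr - e * geom e) * real (M j) powr - e"
    by (simp add: algebra_simps)
  finally show ?case by (simp only: geom_fixpoint[OF assms])
qed

lemma sum_M_powr_minus_lessThan_le:
  assumes "0 < e" shows "(\<Sum>N<K. real (M N) powr - e) \<le> geom e"
  using sum_M_powr_minus_le[OF assms, of 0 K] by (simp add: atLeast0LessThan)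

text \<open>The reverse Jensen inequality: subadditivity moves the power inside the finite sum, and
  the normalisation \<open>M J powr p\<close> instead of \<open>M J\<close> leaves the factor
  \<open>M J powr (1 - p)\<close>.\<close>

lemma av_powr_le:
  assumes p: "0 < p" "p \<le> 1" and g: "\<And>c. c \<in> G \<Longrightarrow> 0 \<le> g c"
  shows "av J g powr p \<le> real (M J) powr (1 - p) * av J (\<lambda>c. g c powr p)"
proof -
  have g': "0 \<le> (\<Sum>c\<in>cyl J. g c)" by (intro sum_nonneg g cyl_G)
  have "av J g powr p = (\<Sum>c\<in>cyl J. g c) powr p / real (M J) powr p"
    using g' by (simp add: av_def powr_divide)
  also have "\<dots> \<le> (\<Sum>c\<in>cyl J. g c powr p) / real (M J) powr p"
    by (intro divide_right_mono powr_sum_le p g cyl_G) auto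
  also have "\<dots> = real (M J) powr (1 - p) * av J (\<lambda>c. g c powr p)"
    by (simp add: av_def powr_diff field_simps)
  finally show ?thesis .
qed

section \<open>Averages against the matching indicators\<close>

lemma matches_nonneg: "0 \<le> matches A t x y"
  by (simp add: matches_def)

lemma depends_on_matches: "depends_on A (\<lambda>x. matches A t x y)" "depends_on A (\<lambda>y. matches A t x y)"
  by (rule depends_onI, simp add: matches_def)+

text \<open>A matching representative is determined by its coordinate \<open>t\<close>, so there are
  at most \<open>m t \<le> B\<close> of them.\<close>

lemma av_matches_le:
  shows "av A (\<lambda>x. matches A t x y) \<le> real B / real (M A)"
proof -
  have "{c \<in> cyl A. \<forall>j<A. j \<noteq> t \<longrightarrow> c j = y j} \<subseteq> (\<lambda>j. (trunc A y)(t := j)) ` {..<m t}"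
  proof
    fix c assume c: "c \<in> {c \<in> cyl A. \<forall>j<A. j \<noteq> t \<longrightarrow> c j = y j}"
    have "c = (trunc A y)(t := c t)"
    proof
      fix k show "c k = ((trunc A y)(t := c t)) k"
        using c by (cases "k < A") (auto simp: trunc_def cyl_def)
    qed
    moreover have "c t < m t" using c by (auto simp: cyl_def G_def)
    ultimately show "c \<in> (\<lambda>j. (trunc A y)(t := j)) ` {..<m t}" by (intro image_eqI[of _ _ "c t"]) auto
  qed
  then have "card {c \<in> cyl A. \<forall>j<A. j \<noteq> t \<longrightarrow> c j = y j} \<le> card ((\<lambda>j. (trunc A y)(t := j)) ` {..<m t})"
    by (intro card_mono) auto
  also have "\<dots> \<le> m t" using card_image_le[of "{..<m t}"] by simp
  also have "\<dots> \<le> B" by (rule m_le)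
  finally have "real (card {c \<in> cyl A. \<forall>j<A. j \<noteq> t \<longrightarrow> c j = y j}) \<le> real B"
    by simp
  moreover have "(\<Sum>c\<in>cyl A. matches A t c y) = real (card {c \<in> cyl A. \<forall>j<A. j \<noteq> t \<longrightarrow> c j = y j})"
    unfolding matches_def by (subst sum.inter_filter[symmetric]) simp_all
  ultimately show ?thesis
    by (simp add: av_def divide_right_mono)
qed

lemma av_av_matches_le:
  assumes p: "0 < p" "p \<le> 1" and h: "depends_on j h" "\<And>x. x \<in> G \<Longrightarrow> 0 \<le> h x"
    and "j \<le> L" "A \<le> L"
  shows "av L (\<lambda>x. av L (\<lambda>y. h y * matches A t x y) powr p)
    \<le> real B / real (M A) * (real (M j) powr (1 - p) + real (M A) powr (1 - p)) * av j (\<lambda>y. h y powr p)"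
proof -
  \<comment> \<open>A level that sees both \<open>h\<close> and \<open>matches\<close>; reverse
    Jensen at level \<open>L\<close> would cost the larger factor
    \<open>M L powr (1 - p)\<close>.\<close>
  define J where "J = max j A"
  have J: "J \<le> L" "j \<le> J" "A \<le> J" using assms by (auto simp: J_def)
  have hp: "depends_on j (\<lambda>y. h y powr p)" by (rule depends_on_comp[OF h(1)])
  have "av L (\<lambda>x. av L (\<lambda>y. h y * matches A t x y) powr p)
    \<le> av L (\<lambda>x. real (M J) powr (1 - p) * av J (\<lambda>y. h y powr p * matches A t x y))"
  proof (rule av_mono)
    fix x assume "x \<in> G"
    have "av L (\<lambda>y. h y * matches A t x y) = av J (\<lambda>y. h y * matches A t x y)"
      by (intro av_eq J depends_on_comp2[where F = "(*)"] depends_on_mono[OF h(1)] depends_on_mono[OF depends_on_matches(2)])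
    also have "\<dots> powr p \<le> real (M J) powr (1 - p) * av J (\<lambda>y. (h y * matches A t x y) powr p)"
      by (intro av_powr_le p mult_nonneg_nonneg h matches_nonneg)
    also have "(\<lambda>y. (h y * matches A t x y) powr p) = (\<lambda>y. h y powr p * matches A t x y)"
      by (auto simp: matches_def)
    finally show "av L (\<lambda>y. h y * matches A t x y) powr p \<le> real (M J) powr (1 - p) * av J (\<lambda>y. h y powr p * matches A t x y)" .
  qed
  \<comment> \<open>Averaging over \<open>x\<close> first isolates the indicator, whose average is
    at most \<open>B / M A\<close>.\<close>
  also have "\<dots> = real (M J) powr (1 - p) * av J (\<lambda>y. h y powr p * av L (\<lambda>x. matches A t x y))"
    by (simp only: av_cmult av_swap[of L J])
  also have "\<dots> \<le> real (M J) powr (1 - p) * av J (\<lambda>y. h y powr p * (real B / real (M A)))"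
    using av_matches_le[of A t] av_eq[OF depends_on_matches(1) \<open>A \<le> L\<close>]
    by (intro mult_left_mono av_mono) auto
  also have "\<dots> = real (M J) powr (1 - p) * (real B / real (M A) * av J (\<lambda>y. h y powr p))"
    by (simp only: av_cmult mult.commute[of _ "real B / real (M A)"])
  also have "\<dots> = real B / real (M A) * real (M J) powr (1 - p) * av j (\<lambda>y. h y powr p)"
    by (simp only: av_eq[OF hp J(2)] mult_ac)
  also have "\<dots> \<le> real B / real (M A) * (real (M j) powr (1 - p) + real (M A) powr (1 - p)) * av j (\<lambda>y. h y powr p)"
    by (intro mult_left_mono mult_right_mono av_nonneg) (auto simp: J_def max_def)
  finally show ?thesis .
qed

section \<open>The maximal inequality\<close>


definition jump :: "(nat \<Rightarrow> (nat \<Rightarrow> nat) \<Rightarrow> complex) \<Rightarrow> nat \<Rightarrow> (nat \<Rightarrow> nat) \<Rightarrow> real" where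
  "jump f j x = doubling_jump (\<lambda>i. norm (f i x)) j"

lemma jump_nonneg: "0 \<le> jump f j x"
  unfolding jump_def by (rule doubling_jump_nonneg) simp

lemma depends_on_doubling_record:
  assumes f: "vmartingale m f" shows "depends_on n (\<lambda>x. doubling_record (\<lambda>i. norm (f i x)) n)"
proof (induction n)
  case 0
  show ?case unfolding doubling_record.simps by (rule depends_on_comp[OF vmartingale_depends_on[OF f]])
next
  case (Suc n)
  then show ?case unfolding doubling_record.simps
    by (intro depends_on_comp2[where F = "\<lambda>a b. if 2 * a \<le> b then b else a"] depends_on_mono[OF Suc]
        depends_on_comp[where F = norm] vmartingale_depends_on[OF f]) auto
qed

lemma depends_on_jump:
  assumes f: "vmartingale m f" shows "depends_on j (jump f j)"
proof (cases j)
  case 0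
  show ?thesis unfolding jump_def[abs_def] 0 doubling_jump.simps
    by (rule depends_on_comp[OF vmartingale_depends_on[OF f]])
next
  case (Suc k)
  show ?thesis unfolding jump_def[abs_def] Suc doubling_jump.simps
    by (intro depends_on_comp2[where F = "(-)"] depends_on_doubling_record[OF f] depends_on_mono[OF depends_on_doubling_record[OF f]]) auto
qed

context
  fixes p :: real
  assumes p0: "0 < p" and p_half: "p < 1/2"
begin

text \<open>Majorant for the \<open>p\<close>-th power of all weighted Fejer means with
  \<open>M N \<le> n < M (Suc N)\<close>. The constant combines the kernel bound with the factor 2
  of the records; \<open>p - 1\<close> adds \<open>- p\<close> from division by \<open>n\<close> and
  \<open>2 * p - 1\<close> from the weight.\<close>

definition block :: "(nat \<Rightarrow> (nat \<Rightarrow> nat) \<Rightarrow> complex) \<Rightarrow> nat \<Rightarrow> (nat \<Rightarrow> nat) \<Rightarrow> real" where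
  "block f N x = (2 * (real B)\<^sup>2) powr p * real (M N) powr (p - 1) *
     (\<Sum>A\<le>N. \<Sum>t\<le>A. \<Sum>j\<le>Suc N. (real (M t) * real (M A)) powr p *
        av (Suc N) (\<lambda>y. jump f j y * matches A t x y) powr p)"

lemma block_nonneg: "0 \<le> block f N x"
  by (simp add: block_def sum_nonneg)

lemma fejer_mean_le_block:
  assumes f: "vmartingale m f" and n: "M N \<le> n" "n < M (Suc N)" and x: "x \<in> G"
  shows "(norm (fejer_mean m f n x) / (real n + 1) powr (1 / p - 2)) powr p \<le> block f N x"
proof -
  define d where "d A t j = av (Suc N) (\<lambda>y. jump f j y * matches A t x y)" for A t j
  define R where "R = (\<Sum>A\<le>N. \<Sum>t\<le>A. \<Sum>j\<le>Suc N. real (M t) * real (M A) * d A t j)"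
  have d: "0 \<le> d A t j" for A t j
    unfolding d_def by (intro av_nonneg mult_nonneg_nonneg jump_nonneg matches_nonneg)
  have R: "0 \<le> R" unfolding R_def by (intro sum_nonneg mult_nonneg_nonneg d) auto
  have n0: "0 < n" using n(1) M_pos[of N] by linarith
  have "av (Suc N) (\<lambda>y. norm (f (Suc N) y) * matches A t x y) \<le> 2 * (\<Sum>j\<le>Suc N. d A t j)" for A t
  proof -
    have "av (Suc N) (\<lambda>y. norm (f (Suc N) y) * matches A t x y)
        \<le> av (Suc N) (\<lambda>y. 2 * (\<Sum>j\<le>Suc N. jump f j y * matches A t x y))"
    proof (rule av_mono)
      fix y
      have "norm (f (Suc N) y) * matches A t x y \<le> 2 * (\<Sum>j\<le>Suc N. jump f j y) * matches A t x y"
        unfolding jump_def sum_doubling_jump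
        by (intro mult_right_mono le_doubling_record matches_nonneg) auto
      then show "norm (f (Suc N) y) * matches A t x y \<le> 2 * (\<Sum>j\<le>Suc N. jump f j y * matches A t x y)"
        by (simp only: sum_distrib_right mult.assoc)
    qed
    then show ?thesis by (simp only: av_cmult av_sum d_def)
  qed
  then have "real n * norm (fejer_mean m f n x)
      \<le> (real B)\<^sup>2 * (\<Sum>A<Suc N. \<Sum>t\<le>A. real (M t) * real (M A) * (2 * (\<Sum>j\<le>Suc N. d A t j)))"
    by (intro order.trans[OF norm_fejer_mean_le[OF f n(2) x]] mult_left_mono sum_mono) auto
  also have "\<dots> = 2 * (real B)\<^sup>2 * R"
    unfolding lessThan_Suc_atMost R_def sum_distrib_left by (intro sum.cong refl) simp
  finally have "norm (fejer_mean m f n x) \<le> 2 * (real B)\<^sup>2 * R / real n"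
    using n0 by (simp add: field_simps)
  also have "\<dots> \<le> 2 * (real B)\<^sup>2 * R / real (M N)"
    using n(1) n0 R by (intro divide_left_mono) auto
  finally have "norm (fejer_mean m f n x) powr p \<le> (2 * (real B)\<^sup>2 * R / real (M N)) powr p"
    using p0 by (intro powr_mono2) auto
  also have "\<dots> = (2 * (real B)\<^sup>2) powr p * R powr p / real (M N) powr p"
    using R by (simp add: powr_divide powr_mult)
  finally have 1: "norm (fejer_mean m f n x) powr p \<le> (2 * (real B)\<^sup>2) powr p * R powr p / real (M N) powr p" .
  \<comment> \<open>The weight raised to the power \<open>p\<close> has exponent
    \<open>1 - 2 * p\<close>, positive because \<open>p < 1/2\<close>.\<close>
  have "real (M N) powr (1 - 2 * p) \<le> (real n + 1) powr (1 - 2 * p)"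
    using n p_half by (intro powr_mono2) auto
  also have "\<dots> = ((real n + 1) powr (1 / p - 2)) powr p"
  proof -
    have "(1 / p - 2) * p = 1 - 2 * p" using p0 by (simp add: field_simps)
    then show ?thesis by (simp add: powr_powr)
  qed
  finally have 2: "real (M N) powr (1 - 2 * p) \<le> ((real n + 1) powr (1 / p - 2)) powr p" .
  have "(norm (fejer_mean m f n x) / (real n + 1) powr (1 / p - 2)) powr p
      = norm (fejer_mean m f n x) powr p / ((real n + 1) powr (1 / p - 2)) powr p"
    by (simp add: powr_divide)
  also have "\<dots> \<le> ((2 * (real B)\<^sup>2) powr p * R powr p / real (M N) powr p) / real (M N) powr (1 - 2 * p)"
    using 1 2 by (intro frac_le) auto
  also have "\<dots> = (2 * (real B)\<^sup>2) powr p * real (M N) powr (p - 1) * R powr p"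
  proof -
    have "real (M N) powr (p - 1) = 1 / (real (M N) powr p * real (M N) powr (1 - 2 * p))"
      unfolding powr_add[symmetric] by (simp add: powr_minus_divide[symmetric])
    then show ?thesis by simp
  qed
  also have "\<dots> \<le> (2 * (real B)\<^sup>2) powr p * real (M N) powr (p - 1) *
      (\<Sum>A\<le>N. \<Sum>t\<le>A. \<Sum>j\<le>Suc N. (real (M t) * real (M A) * d A t j) powr p)"
    unfolding R_def using p0 p_half d
    by (intro mult_left_mono order.trans[OF powr_sum_le] sum_mono sum_nonneg mult_nonneg_nonneg) auto
  also have "\<dots> = block f N x"
    using d unfolding block_def d_def[symmetric] by (simp only: powr_mult mult_nonneg_nonneg of_nat_0_le_iff)
  finally show ?thesis .
qed

section \<open>Integrating and summing the block majorants\<close>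

definition mass :: "(nat \<Rightarrow> (nat \<Rightarrow> nat) \<Rightarrow> complex) \<Rightarrow> nat \<Rightarrow> real" where
  "mass f j = av j (\<lambda>y. jump f j y powr p)"

lemma mass_nonneg: "0 \<le> mass f j"
  unfolding mass_def by (intro av_nonneg) auto

lemma depends_on_block: "depends_on (Suc N) (block f N)"
proof (rule depends_onI)
  fix x y :: "nat \<Rightarrow> nat" assume "\<And>j. j < Suc N \<Longrightarrow> x j = y j"
  then have "matches A t x = matches A t y" if "A \<le> N" for A t
    using that by (auto simp: matches_def fun_eq_iff)
  then show "block f N x = block f N y"
    by (simp add: block_def)
qed

definition "block_const = (2 * (real B)\<^sup>2) powr p * real B * geom p"
text \<open>The two summands pay for the two kinds of terms in \<open>av_block_le\<close>;
  \<open>B powr (1 - p)\<close> is the price of replacing \<open>M N\<close> by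
  \<open>M (Suc N)\<close>.\<close>

definition "total_const = block_const * (geom (1 - 2 * p) * real B powr (1 - p) * geom (1 - p) + geom p * geom (1 - 2 * p))"

lemma block_const_nonneg: "0 \<le> block_const"
  using geom_ge1[OF p0] by (simp add: block_const_def)

lemma av_block_le:
  assumes f: "vmartingale m f"
  shows "av (Suc N) (block f N) \<le> block_const * (\<Sum>j\<le>Suc N. mass f j *
    (geom (1 - 2 * p) * real (M N) powr (p - 1) * real (M j) powr (1 - p) + geom p * real (M N) powr (2 * p - 1)))"
proof -
  define k where "k = (2 * (real B)\<^sup>2) powr p * real (M N) powr (p - 1)"
  have k: "0 \<le> k" by (simp add: k_def)
  define b where "b A j = real B / real (M A) * (real (M j) powr (1 - p) + real (M A) powr (1 - p)) * mass f j" for A j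
  have b: "0 \<le> b A j" for A j unfolding b_def by (intro mult_nonneg_nonneg mass_nonneg) auto
  have "av (Suc N) (block f N) = k * (\<Sum>A\<le>N. \<Sum>t\<le>A. \<Sum>j\<le>Suc N. (real (M t) * real (M A)) powr p *
        av (Suc N) (\<lambda>x. av (Suc N) (\<lambda>y. jump f j y * matches A t x y) powr p))"
    unfolding block_def[abs_def] k_def by (simp only: av_cmult av_sum)
  also have "\<dots> \<le> k * (\<Sum>A\<le>N. \<Sum>t\<le>A. \<Sum>j\<le>Suc N. (real (M t) * real (M A)) powr p * b A j)"
    unfolding b_def mass_def using p0 p_half
    by (intro mult_left_mono[OF _ k] sum_mono mult_left_mono av_av_matches_le depends_on_jump f jump_nonneg) auto
  also have "\<dots> = k * (\<Sum>A\<le>N. \<Sum>j\<le>Suc N. (\<Sum>t\<le>A. real (M t) powr p) * (real (M A) powr p * b A j))"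
  proof -
    have "(real (M t) * real (M A)) powr p = real (M t) powr p * real (M A) powr p" for t A
      by (simp add: powr_mult)
    then have "(\<Sum>t\<le>A. \<Sum>j\<le>Suc N. (real (M t) * real (M A)) powr p * b A j)
        = (\<Sum>j\<le>Suc N. (\<Sum>t\<le>A. real (M t) powr p) * (real (M A) powr p * b A j))" for A
      by (subst sum.swap) (simp only: sum_distrib_right mult.assoc)
    then show ?thesis by (simp only:)
  qed
  also have "\<dots> \<le> k * (\<Sum>A\<le>N. \<Sum>j\<le>Suc N. (geom p * real (M A) powr p) * (real (M A) powr p * b A j))"
    by (intro mult_left_mono[OF _ k] sum_mono mult_right_mono sum_M_powr_le p0 mult_nonneg_nonneg b) auto
  \<comment> \<open>The factor \<open>M A powr (2 * p) / M A\<close> decays in \<open>A\<close>,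
    which is where \<open>2 * p < 1\<close> enters; multiplied by \<open>M A powr (1 - p)\<close> it
    grows like \<open>M A powr p\<close>.\<close>
  also have "\<dots> = k * (\<Sum>A\<le>N. \<Sum>j\<le>Suc N. geom p * real B * mass f j *
      (real (M A) powr - (1 - 2 * p) * real (M j) powr (1 - p) + real (M A) powr p))"
  proof -
    have "(geom p * real (M A) powr p) * (real (M A) powr p * b A j) = geom p * real B * mass f j *
      (real (M A) powr - (1 - 2 * p) * real (M j) powr (1 - p) + real (M A) powr p)" for A j
    proof -
      have 1: "real (M A) powr - (1 - 2 * p) = real (M A) powr p * real (M A) powr p / real (M A)"
        unfolding powr_add[symmetric] by (simp add: powr_diff)
      have 2: "real (M A) powr p = real (M A) powr p * real (M A) powr p / real (M A) * real (M A) powr (1 - p)"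
        by (simp add: powr_diff)
      have "(geom p * real (M A) powr p) * (real (M A) powr p * b A j) = geom p * real B * mass f j *
        (real (M A) powr p * real (M A) powr p / real (M A) * real (M j) powr (1 - p)
         + real (M A) powr p * real (M A) powr p / real (M A) * real (M A) powr (1 - p))"
        by (simp add: b_def field_simps)
      then show ?thesis by (simp only: 1 2[symmetric])
    qed
    then show ?thesis by (simp only:)
  qed
  also have "\<dots> = k * (\<Sum>j\<le>Suc N. geom p * real B * mass f j *
      ((\<Sum>A<Suc N. real (M A) powr - (1 - 2 * p)) * real (M j) powr (1 - p) + (\<Sum>A\<le>N. real (M A) powr p)))"
    by (subst sum.swap) (simp only: lessThan_Suc_atMost sum_distrib_left sum_distrib_right sum.distrib distrib_left)
  also have "\<dots> \<le> k * (\<Sum>j\<le>Suc N. geom p * real B * mass f j *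
      (geom (1 - 2 * p) * real (M j) powr (1 - p) + geom p * real (M N) powr p))"
    using p_half geom_ge1[OF p0]
    by (intro mult_left_mono[OF _ k] sum_mono mult_left_mono add_mono mult_right_mono
        sum_M_powr_minus_lessThan_le sum_M_powr_le p0 mult_nonneg_nonneg mass_nonneg) auto
  also have "\<dots> = block_const * (\<Sum>j\<le>Suc N. mass f j *
    (geom (1 - 2 * p) * real (M N) powr (p - 1) * real (M j) powr (1 - p) + geom p * real (M N) powr (2 * p - 1)))"
  proof -
    have 1: "real (M N) powr (2 * p - 1) = real (M N) powr (p - 1) * real (M N) powr p"
      unfolding powr_add[symmetric] by simp
    show ?thesis
      unfolding 1 block_const_def k_def sum_distrib_left by (intro sum.cong refl) (simp add: algebra_simps)
  qed
  finally show ?thesis .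
qed

text \<open>The first kind of term is summed over \<open>N\<close> for fixed \<open>j\<close>, where
  the tail cancels \<open>M j powr (1 - p)\<close>. The second kind has a summable weight in
  \<open>N\<close> alone.\<close>

lemma sum_av_block_le:
  assumes f: "vmartingale m f"
  shows "(\<Sum>N<K. av (Suc N) (block f N)) \<le> total_const * (\<Sum>j\<le>K. mass f j)"
proof -
  have g1: "0 \<le> geom p" and g2: "0 \<le> geom (1 - 2 * p)" and g3: "0 \<le> geom (1 - p)"
    using geom_ge1[OF p0] geom_ge1[of "1 - 2 * p"] geom_ge1[of "1 - p"] p0 p_half by auto
  let ?S = "\<Sum>j\<le>K. mass f j"
  have S: "0 \<le> ?S" by (intro sum_nonneg mass_nonneg)
  \<comment> \<open>Since \<open>j\<close> runs up to \<open>Suc N\<close>, the negative power is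
    first moved to \<open>M (Suc N)\<close> using \<open>M (Suc N) \<le> B * M N\<close>, so that
    after reindexing \<open>j \<le> N\<close>.\<close>
  have "(\<Sum>N<K. \<Sum>j\<le>Suc N. mass f j * (real (M N) powr (p - 1) * real (M j) powr (1 - p)))
    \<le> (\<Sum>N<K. \<Sum>j\<le>Suc N. mass f j * (real B powr (1 - p) * real (M (Suc N)) powr - (1 - p) * real (M j) powr (1 - p)))"
  proof (intro sum_mono mult_left_mono mult_right_mono mass_nonneg)
    fix N
    have "real (M (Suc N)) powr (1 - p) \<le> (real B * real (M N)) powr (1 - p)"
      using p_half m_le[of N] by (intro powr_mono2) (auto simp: M_Suc intro!: mult_right_mono)
    then have "real (M (Suc N)) powr (1 - p) \<le> real B powr (1 - p) * real (M N) powr (1 - p)"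
      by (simp add: powr_mult)
    moreover have "1 / u \<le> w * (1 / v)" if "v \<le> w * u" "0 < v" "0 < u" for u v w :: real
      using that by (simp add: field_simps)
    ultimately have "1 / real (M N) powr (1 - p) \<le> real B powr (1 - p) * (1 / real (M (Suc N)) powr (1 - p))"
      by simp
    moreover have "real (M N) powr (p - 1) = 1 / real (M N) powr (1 - p)"
      "real (M (Suc N)) powr - (1 - p) = 1 / real (M (Suc N)) powr (1 - p)"
      by (simp_all add: powr_minus_divide[symmetric])
    ultimately show "real (M N) powr (p - 1) \<le> real B powr (1 - p) * real (M (Suc N)) powr - (1 - p)"
      by (simp only:)
  qed auto
  also have "\<dots> = (\<Sum>N\<in>{1..<Suc K}. \<Sum>j\<le>N. mass f j * (real B powr (1 - p) * real (M N) powr - (1 - p) * real (M j) powr (1 - p)))"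
    by (rule sum.reindex_bij_witness[of _ "\<lambda>i. i - 1" Suc]) auto
  also have "\<dots> \<le> (\<Sum>N\<in>{..<Suc K}. \<Sum>j\<le>N. mass f j * (real B powr (1 - p) * real (M N) powr - (1 - p) * real (M j) powr (1 - p)))"
    by (intro sum_mono2 sum_nonneg mult_nonneg_nonneg mass_nonneg) auto
  also have "\<dots> = (\<Sum>j\<le>K. \<Sum>N\<in>{j..<Suc K}. mass f j * (real B powr (1 - p) * real (M N) powr - (1 - p) * real (M j) powr (1 - p)))"
    unfolding sum.Sigma[OF finite_lessThan ballI[OF finite_atMost]] sum.Sigma[OF finite_atMost ballI[OF finite_atLeastLessThan]]
    by (rule sum.reindex_bij_witness[of _ "\<lambda>(a, b). (b, a)" "\<lambda>(a, b). (b, a)"]) auto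
  also have "\<dots> = (\<Sum>j\<le>K. mass f j * (real B powr (1 - p) * real (M j) powr (1 - p) * (\<Sum>N\<in>{j..<j + (Suc K - j)}. real (M N) powr - (1 - p))))"
    by (intro sum.cong refl) (auto simp: sum_distrib_left mult_ac simp del: sum.op_ivl_Suc intro!: sum.cong)
  also have "\<dots> \<le> (\<Sum>j\<le>K. mass f j * (real B powr (1 - p) * real (M j) powr (1 - p) * (geom (1 - p) * real (M j) powr - (1 - p))))"
    using p_half by (intro sum_mono mult_left_mono mass_nonneg sum_M_powr_minus_le) auto
  also have "\<dots> = real B powr (1 - p) * geom (1 - p) * ?S"
  proof -
    have "mass f j * (real B powr (1 - p) * real (M j) powr (1 - p) * (geom (1 - p) * real (M j) powr - (1 - p)))
        = real B powr (1 - p) * geom (1 - p) * mass f j" for j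
    proof -
      have "real (M j) powr (1 - p) * real (M j) powr - (1 - p) = 1"
        unfolding powr_add[symmetric] by simp
      then show ?thesis by algebra
    qed
    then show ?thesis by (simp only: sum_distrib_left)
  qed
  finally have 1: "(\<Sum>N<K. \<Sum>j\<le>Suc N. mass f j * (real (M N) powr (p - 1) * real (M j) powr (1 - p)))
    \<le> real B powr (1 - p) * geom (1 - p) * ?S" .
  \<comment> \<open>Here no power of \<open>M j\<close> has to be cancelled, so each inner sum is
    enlarged to \<open>?S\<close>.\<close>
  have "(\<Sum>N<K. \<Sum>j\<le>Suc N. mass f j * real (M N) powr (2 * p - 1)) \<le> (\<Sum>N<K. ?S * real (M N) powr - (1 - 2 * p))"
    unfolding sum_distrib_right[symmetric]
    by (intro sum_mono mult_mono sum_mono2 mass_nonneg S) auto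
  also have "\<dots> = ?S * (\<Sum>N<K. real (M N) powr - (1 - 2 * p))"
    by (simp add: sum_distrib_left)
  also have "\<dots> \<le> ?S * geom (1 - 2 * p)"
    using p_half S by (intro mult_left_mono sum_M_powr_minus_lessThan_le) auto
  finally have 2: "(\<Sum>N<K. \<Sum>j\<le>Suc N. mass f j * real (M N) powr (2 * p - 1)) \<le> geom (1 - 2 * p) * ?S"
    by (simp add: mult.commute)
  have "(\<Sum>N<K. av (Suc N) (block f N)) \<le> (\<Sum>N<K. block_const * (\<Sum>j\<le>Suc N. mass f j *
    (geom (1 - 2 * p) * real (M N) powr (p - 1) * real (M j) powr (1 - p) + geom p * real (M N) powr (2 * p - 1))))"
    by (intro sum_mono av_block_le f)
  also have "\<dots> = block_const * (geom (1 - 2 * p) * (\<Sum>N<K. \<Sum>j\<le>Suc N. mass f j * (real (M N) powr (p - 1) * real (M j) powr (1 - p)))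
      + geom p * (\<Sum>N<K. \<Sum>j\<le>Suc N. mass f j * real (M N) powr (2 * p - 1)))"
    unfolding sum_distrib_left sum.distrib[symmetric] distrib_left by (intro sum.cong refl) (simp add: mult_ac)
  also have "\<dots> \<le> block_const * (geom (1 - 2 * p) * (real B powr (1 - p) * geom (1 - p) * ?S) + geom p * (geom (1 - 2 * p) * ?S))"
    by (intro mult_left_mono add_mono 1 2 g1 g2 block_const_nonneg)
  also have "\<dots> = total_const * ?S"
    by (simp add: total_const_def algebra_simps)
  finally show ?thesis .
qed

text \<open>Lifted to the common level \<open>K\<close>, the jumps are bounded pointwise by the
  record, which is one of the values \<open>norm (f i x)\<close> and so lies below the maximal
  function.\<close>

lemma sum_mass_le:
  assumes f: "vmartingale m f"
  shows "ennreal (\<Sum>j\<le>K. mass f j) \<le> ennreal (geom p) * (\<integral>\<^sup>+x. ennpow (maximal_fn f x) p \<partial>\<mu>)"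
proof -
  let ?h = "\<lambda>x. doubling_record (\<lambda>i. norm (f i x)) K"
  have "(\<Sum>j\<le>K. mass f j) = (\<Sum>j\<le>K. av K (\<lambda>y. jump f j y powr p))"
    unfolding mass_def
    by (intro sum.cong refl av_eq[symmetric] depends_on_comp[where F = "\<lambda>r. r powr p"] depends_on_jump[OF f]) auto
  also have "\<dots> = av K (\<lambda>y. \<Sum>j\<le>K. jump f j y powr p)"
    by (rule av_sum[symmetric])
  also have "\<dots> \<le> av K (\<lambda>y. geom p * ?h y powr p)"
    unfolding jump_def by (intro av_mono sum_doubling_jump_powr p0) auto
  also have "\<dots> = geom p * av K (\<lambda>y. ?h y powr p)"
    by (rule av_cmult)
  finally have "ennreal (\<Sum>j\<le>K. mass f j) \<le> ennreal (geom p * av K (\<lambda>y. ?h y powr p))"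
    by (rule ennreal_leI)
  also have "\<dots> = ennreal (geom p) * ennreal (av K (\<lambda>y. ?h y powr p))"
    using geom_ge1[OF p0] by (intro ennreal_mult av_nonneg) auto
  also have "ennreal (av K (\<lambda>y. ?h y powr p)) = (\<integral>\<^sup>+x. ennreal (?h x powr p) \<partial>\<mu>)"
    by (intro nn_integral_depends_on(1)[symmetric] depends_on_comp[where F = "\<lambda>r. r powr p"] depends_on_doubling_record[OF f]) auto
  also have "\<dots> \<le> (\<integral>\<^sup>+x. ennpow (maximal_fn f x) p \<partial>\<mu>)"
  proof (rule nn_integral_mono)
    fix x
    obtain i where i: "?h x = norm (f i x)"
      using doubling_record_attained[of K "\<lambda>i. norm (f i x)"] by auto
    have "ennreal (?h x powr p) = ennpow (ennreal (norm (f i x))) p"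
      by (simp add: i ennpow_ennreal)
    also have "\<dots> \<le> ennpow (maximal_fn f x) p"
      using p0 by (intro ennpow_mono) (auto simp: maximal_fn_def intro: SUP_upper)
    finally show "ennreal (?h x powr p) \<le> ennpow (maximal_fn f x) p" .
  qed
  finally show ?thesis by (simp add: mult_left_mono)
qed

section \<open>From blocks to the maximal operator\<close>

lemma exists_block:
  assumes "1 \<le> n" obtains N where "M N \<le> n" "n < M (Suc N)"
proof -
  define K where "K = (LEAST K. n < M K)"
  have K: "n < M K" unfolding K_def by (rule LeastI[of _ n]) (rule less_M)
  then have "K \<noteq> 0" using assms by (intro notI) simp
  then obtain N where N: "K = Suc N" by (cases K) auto
  then have "\<not> n < M N" using not_less_Least[of N "\<lambda>K. n < M K"] by (simp add: K_def)
  then show thesis using K N by (intro that[of N]) simp_all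
qed

text \<open>Every \<open>n \<ge> 1\<close> lies in a block, and a single block is at most the whole
  series. Taking \<open>p\<close>-th roots before the supremum gives one bound for all
  \<open>n\<close>.\<close>

lemma maximal_fejer_le:
  assumes f: "vmartingale m f" and x: "x \<in> G"
  shows "ennpow (SUP n\<in>{1..}. ennreal (norm (fejer_mean m f n x) / (real n + 1) powr (1/p - 2))) p
    \<le> (\<Sum>N. ennreal (block f N x))"
proof (cases "(\<Sum>N. ennreal (block f N x)) = \<infinity>")
  case False
  then obtain w where w: "0 \<le> w" "(\<Sum>N. ennreal (block f N x)) = ennreal w"
    by (cases "\<Sum>N. ennreal (block f N x)") auto
  have "norm (fejer_mean m f n x) / (real n + 1) powr (1/p - 2) \<le> w powr (1 / p)" if "n \<in> {1..}" for n
  proof -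
    let ?s = "norm (fejer_mean m f n x) / (real n + 1) powr (1/p - 2)"
    have "1 \<le> n" using that by simp
    then obtain N where "M N \<le> n" "n < M (Suc N)" by (rule exists_block)
    then have "?s powr p \<le> block f N x" by (rule fejer_mean_le_block[OF f _ _ x])
    also have "ennreal (block f N x) \<le> ennreal w"
      using sum_le_suminf[of "\<lambda>N. ennreal (block f N x)" "{N}"] w(2) by auto
    then have "block f N x \<le> w" using w(1) by simp
    finally have "(?s powr p) powr (1 / p) \<le> w powr (1 / p)"
      using p0 by (intro powr_mono2) auto
    then show ?thesis using p0 by (simp add: powr_powr)
  qed
  then have "(SUP n\<in>{1..}. ennreal (norm (fejer_mean m f n x) / (real n + 1) powr (1/p - 2))) \<le> ennreal (w powr (1 / p))"
    by (intro SUP_least ennreal_leI) auto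
  then have "ennpow (SUP n\<in>{1..}. ennreal (norm (fejer_mean m f n x) / (real n + 1) powr (1/p - 2))) p
      \<le> ennpow (ennreal (w powr (1 / p))) p"
    using p0 by (intro ennpow_mono) auto
  also have "\<dots> = ennreal w"
    using p0 w(1) by (simp add: ennpow_ennreal powr_powr)
  finally show ?thesis using w(2) by simp
qed simp

lemma total_const_nonneg: "0 \<le> total_const"
  using geom_ge1[OF p0] geom_ge1[of "1 - 2 * p"] geom_ge1[of "1 - p"] p0 p_half block_const_nonneg
  unfolding total_const_def by (intro mult_nonneg_nonneg add_nonneg_nonneg) auto

text \<open>The series of blocks is integrated term by term, and its partial sums are bounded
  uniformly in \<open>K\<close>.\<close>

lemma nn_integral_maximal_fejer_le:
  assumes f: "vmartingale m f"
  shows "(\<integral>\<^sup>+x. ennpow (SUP n\<in>{1..}. ennreal (norm (fejer_mean m f n x) / (real n + 1) powr (1/p - 2))) p \<partial>\<mu>)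
    \<le> ennreal (total_const * geom p) * (\<integral>\<^sup>+x. ennpow (maximal_fn f x) p \<partial>\<mu>)" (is "?L \<le> _ * ?I")
proof -
  have "?L \<le> (\<integral>\<^sup>+x. (\<Sum>N. ennreal (block f N x)) \<partial>\<mu>)"
    by (intro nn_integral_mono maximal_fejer_le f) (simp add: space_mu)
  also have "\<dots> = (\<Sum>N. \<integral>\<^sup>+x. ennreal (block f N x) \<partial>\<mu>)"
    by (intro nn_integral_suminf nn_integral_depends_on(2)[OF depends_on_block] block_nonneg)
  also have "\<dots> = (\<Sum>N. ennreal (av (Suc N) (block f N)))"
    by (intro suminf_cong nn_integral_depends_on(1) depends_on_block block_nonneg)
  also have "\<dots> \<le> ennreal (total_const * geom p) * ?I"
    unfolding suminf_eq_SUP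
  proof (rule SUP_least)
    fix K
    have "(\<Sum>N<K. ennreal (av (Suc N) (block f N))) = ennreal (\<Sum>N<K. av (Suc N) (block f N))"
      by (intro sum_ennreal av_nonneg block_nonneg)
    also have "\<dots> \<le> ennreal (total_const * (\<Sum>j\<le>K. mass f j))"
      by (intro ennreal_leI sum_av_block_le f)
    also have "\<dots> = ennreal total_const * ennreal (\<Sum>j\<le>K. mass f j)"
      by (intro ennreal_mult total_const_nonneg sum_nonneg mass_nonneg)
    also have "\<dots> \<le> ennreal total_const * (ennreal (geom p) * ?I)"
      by (intro mult_left_mono sum_mass_le f) auto
    also have "\<dots> = ennreal (total_const * geom p) * ?I"
      using geom_ge1[OF p0] total_const_nonneg by (simp add: ennreal_mult mult.assoc)
    finally show "(\<Sum>N<K. ennreal (av (Suc N) (block f N))) \<le> ennreal (total_const * geom p) * ?I" .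
  qed
  finally show ?thesis .
qed

lemma Lp_norm_maximal_fejer_le:
  assumes f: "vmartingale m f" and fin: "Hp_norm m p f < \<infinity>"
  shows "Lp_norm m p (\<lambda>x. SUP n\<in>{1..}. ennreal (norm (fejer_mean m f n x) / (real n + 1) powr (1/p - 2)))
    \<le> ennreal ((total_const * geom p) powr (1 / p)) * Hp_norm m p f"
proof -
  let ?I = "\<integral>\<^sup>+x. ennpow (maximal_fn f x) p \<partial>\<mu>"
  \<comment> \<open>Finiteness of the \<open>H_p\<close> norm allows the remaining powers to be
    computed with real numbers.\<close>
  have "?I \<noteq> \<infinity>"
    using fin by (auto simp: Hp_norm_def Lp_norm_def ennpow_def)
  then obtain i where i: "0 \<le> i" "?I = ennreal i" by (cases ?I) auto
  have D: "0 \<le> total_const * geom p" using total_const_nonneg geom_ge1[OF p0] by simp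
  have "Lp_norm m p (\<lambda>x. SUP n\<in>{1..}. ennreal (norm (fejer_mean m f n x) / (real n + 1) powr (1/p - 2)))
      \<le> ennpow (ennreal (total_const * geom p) * ?I) (1 / p)"
    unfolding Lp_norm_def using p0 by (intro ennpow_mono nn_integral_maximal_fejer_le f) auto
  also have "\<dots> = ennreal ((total_const * geom p * i) powr (1 / p))"
    using D i by (simp add: ennpow_ennreal flip: ennreal_mult)
  also have "\<dots> = ennreal ((total_const * geom p) powr (1 / p)) * ennreal (i powr (1 / p))"
    using D i by (simp add: powr_mult ennreal_mult)
  also have "ennreal (i powr (1 / p)) = Hp_norm m p f"
    using i by (simp add: Hp_norm_def Lp_norm_def ennpow_ennreal)
  finally show ?thesis .
qed

end
end

theorem theorem1:
  fixes p :: real and m :: "nat \<Rightarrow> nat"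
  assumes "0 < p" and "p < 1/2" and "bounded_gen_seq m"
  shows "\<exists>c::real. \<forall>f. vmartingale m f \<longrightarrow> Hp_norm m p f < \<infinity> \<longrightarrow>
           Lp_norm m p (\<lambda>x. SUP n\<in>{1..}. ennreal (norm (fejer_mean m f n x) / (real n + 1) powr (1/p - 2)))
             \<le> ennreal c * Hp_norm m p f"
proof -
  obtain B where "\<And>k. 2 \<le> m k" "\<And>k. m k \<le> B"
    using assms(3) by (auto simp: bounded_gen_seq_def)
  then interpret vilenkin_group m B by unfold_locales
  show ?thesis
    \<comment> \<open>The constant is built from \<open>p\<close> and \<open>B\<close> alone, so one
      witness serves all \<open>f\<close>.\<close>
    using Lp_norm_maximal_fejer_le[OF assms(1,2)] by blast
qed

end
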